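(* Let $\mathcal{E}$ be a locally Cartesian closed category equipped with a probability monad $\mathcal{P}$, and $(\mathbb{T},+,0)$ a monoid in $\mathcal{E}$. The categories $\mathbf{RDyn}^{\mathbb{T}}(p,\theta)$ of open random dynamical systems over closed measure-preserving systems $(\theta,\beta)$ on interfaces $p$ collect into a doubly-indexed category $\mathbf{RDyn}^{\mathbb{T}}:\mathbf{Poly}_{\mathcal{E}}\times\mathbf{Cat}(\mathbf{B}\mathbb{T},\mathcal{E})_{\mathcal{P}}\to\mathbf{Cat}$, with the following actions. (1) For a morphism of polynomials $\varphi:p\to q$ and a measure-preserving system $(\theta,\beta)$, the functor $\mathbf{RDyn}^{\mathbb{T}}(\varphi,\theta):\mathbf{RDyn}^{\mathbb{T}}(p,\theta)\to\mathbf{RDyn}^{\mathbb{T}}(q,\theta)$ sends $(\pi_X:X\to\Omega,\vartheta^o,\vartheta^u)$ to $(\pi_X,\ \varphi_1\circ\vartheta^o,\ \vartheta^u\circ{\vartheta^o}^{*}\varphi^{\#})$, the two maps being $$\mathbb{T}\times X\xrightarrow{\vartheta^o}p(1)\xrightarrow{\varphi_1}q(1),\qquad \sum_{t:\mathbb{T}}\sum_{x:X}q[\varphi_1\circ\vartheta^o(t,x)]\xrightarrow{{\vartheta^o}^{*}\varphi^{\#}}\sum_{t:\mathbb{T}}\sum_{x:X}p[\vartheta^o(t,x)]\xrightarrow{\vartheta^u}X,$$ and sends a morphism $f$ to the same underlying map $f:X\to Y$ of state spaces. (2) For a morphism $\phi:(\theta,\beta)\to(\theta',\beta')$ of closed measure-preserving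 systems and a polynomial $p$, the functor $\mathbf{RDyn}^{\mathbb{T}}(p,\phi):\mathbf{RDyn}^{\mathbb{T}}(p,\theta)\to\mathbf{RDyn}^{\mathbb{T}}(p,\theta')$ is given by post-composition: $(\pi_X,\vartheta^o,\vartheta^u)\mapsto(\phi\circ\pi_X,\vartheta^o,\vartheta^u)$, and a morphism $f$ is sent to the same underlying map $f:X\to Y$.
   Context: Polynomials. A polynomial functor on $\mathcal{E}$ is a coproduct of representables $p=\sum_{i:p(1)}y^{p[i]}$, $y^A=\mathcal{E}(A,-)$; equivalently a bundle $p:\sum_{i:p(1)}p[i]\to p(1)$ in $\mathcal{E}$ with fibres $p[i]$. $\mathbf{Poly}_{\mathcal{E}}$ is the full subcategory of $[\mathcal{E},\mathcal{E}]$ on these. A morphism $\varphi:p\to q$ is a pair of a map $\varphi_1:p(1)\to q(1)$ and a map $\varphi^{\#}:\sum_{i:p(1)}q[\varphi_1(i)]\to\sum_{i:p(1)}p[i]$ over $p(1)$. A section of $p$ is $\sigma:p(1)\to\sum_{i}p[i]$ with $p\circ\sigma=\mathrm{id}$. Closed systems. A closed dynamical system $\theta$ with time $\mathbb{T}$ is an object $\theta( * )$ of $\mathcal{E}$ (state space) with endomorphisms $\theta(t)$, $t:\mathbb{T}$ (equivalently a map $\mathbb{T}\times\theta( * )\to\theta( * )$), with $\theta(0)=\mathrm{id}$ and $\theta(s+t)=\theta(s)\circ\theta(t)$; these are objects of $\mathbf{Cat}(\mathbf{B}\mathbb{T},\mathcal{E})$ ($\mathbf{B}\mathbb{T}$ the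 one-object delooping), whose morphisms are maps of state spaces commuting with the flows. A closed measure-preserving system $(\theta,\beta)$ is a closed system $\theta$ with a measure $\beta:1\to\mathcal{P}\theta( * )$ such that $\mathcal{P}\theta(t)\circ\beta=\beta$ for all $t$. These are the objects of $\mathbf{Cat}(\mathbf{B}\mathbb{T},\mathcal{E})_{\mathcal{P}}$; a morphism $\phi:(\theta,\beta)\to(\theta',\beta')$ is a map $\phi:\theta( * )\to\theta'( * )$ with $\phi\circ\theta(t)=\theta'(t)\circ\phi$ for all $t$ and $\mathcal{P}\phi\circ\beta=\beta'$. Open random systems. Let $\Omega=\theta( * )$. An open random dynamical system over $(\theta,\beta)$ on $p$ is a tuple $\vartheta=(\pi:S\to\Omega,\vartheta^o,\vartheta^u)$ with $\vartheta^o:\mathbb{T}\times S\to p(1)$, $\vartheta^u:\sum_{t:\mathbb{T}}\sum_{s:S}p[\vartheta^o(t,s)]\to S$ such that, for every section $\sigma$ of $p$, the closure $\vartheta^\sigma(t)=\vartheta^u(t)\circ\vartheta^o(t)^{*}\sigma:S\to S$ (with $\vartheta^o(t)^{*}\sigma:S\to\sum_{s}p[\vartheta^o(t,s)]$ the pulled-back section) is a closed dynamical system with $\pi\circ\vartheta^\sigma(t)=\theta(t)\circ\pi$ for all $t$, i.e. $\pi$ makes $\vartheta^\sigma$ an object of $\mathbf{Cat}(\mathbf{B}\mathbb{T},\mathcal{E})/\theta$. These are the objects of $\mathbf{RDyn}^{\mathbb{T}}(p,\theta)$; a morphism $(\pi_X,\vartheta^o,\vartheta^u)\to(\pi_Y,\psi^o,\psi^u)$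 is a map $f:X\to Y$ with $\pi_Y\circ f=\pi_X$ and $f\circ\vartheta^\sigma(t)=\psi^\sigma(t)\circ f$ for all $t$ and all sections $\sigma$ of $p$. A "(doubly-)indexed category" here is a (pseudo)functor into $\mathbf{Cat}$. *)

theory Defs
  imports "HOL-Library.FuncSet"
begin

section \<open>Categories and functors\<close>

record ('o, 'm) cat =
  Ob  :: "'o set"
  Ar  :: "'m set"
  dm  :: "'m \<Rightarrow> 'o"
  cd  :: "'m \<Rightarrow> 'o"
  ide :: "'o \<Rightarrow> 'm"
  cmp :: "'m \<Rightarrow> 'm \<Rightarrow> 'm"  (infixr "\<cdot>\<index>" 70)

definition hom :: "('o, 'm) cat \<Rightarrow> 'o \<Rightarrow> 'o \<Rightarrow> 'm set" where
  "hom C A B = {f \<in> Ar C. dm C f = A \<and> cd C f = B}"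

locale category =
  fixes C :: "('o, 'm) cat" (structure)
  assumes dm_closed: "f \<in> Ar C \<Longrightarrow> dm C f \<in> Ob C"
    and cd_closed: "f \<in> Ar C \<Longrightarrow> cd C f \<in> Ob C"
    and ide_hom: "A \<in> Ob C \<Longrightarrow> ide C A \<in> hom C A A"
    and cmp_hom: "f \<in> hom C A B \<Longrightarrow> g \<in> hom C B D \<Longrightarrow> g \<cdot> f \<in> hom C A D"
    and ide_left: "f \<in> hom C A B \<Longrightarrow> ide C B \<cdot> f = f"
    and ide_right: "f \<in> hom C A B \<Longrightarrow> f \<cdot> ide C A = f"
    and assoc: "f \<in> hom C A B \<Longrightarrow> g \<in> hom C B D \<Longrightarrow> h \<in> hom C D D'
                \<Longrightarrow> (h \<cdot> g) \<cdot> f = h \<cdot> (g \<cdot> f)"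

record ('o, 'm, 'p, 'n) cfunctor =
  Src :: "('o, 'm) cat"
  Tgt :: "('p, 'n) cat"
  fob :: "'o \<Rightarrow> 'p"
  far :: "'m \<Rightarrow> 'n"

text \<open>The two maps are required to be extensional (\<open>undefined\<close> off their domains), so that
  equality of functors as HOL values is equality of functors.\<close>

locale is_functor =
  fixes F :: "('o, 'm, 'p, 'n) cfunctor"
  assumes src: "category (Src F)"
    and tgt: "category (Tgt F)"
    and fob_closed: "fob F \<in> Ob (Src F) \<rightarrow>\<^sub>E Ob (Tgt F)"
    and far_ext: "far F \<in> extensional (Ar (Src F))"
    and far_hom: "f \<in> hom (Src F) A B \<Longrightarrow> far F f \<in> hom (Tgt F) (fob F A) (fob F B)"
    and far_ide: "A \<in> Ob (Src F) \<Longrightarrow> far F (ide (Src F) A) = ide (Tgt F) (fob F A)"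
    and far_cmp: "f \<in> hom (Src F) A B \<Longrightarrow> g \<in> hom (Src F) B D
                  \<Longrightarrow> far F (g \<cdot>\<^bsub>Src F\<^esub> f) = far F g \<cdot>\<^bsub>Tgt F\<^esub> far F f"

definition id_functor :: "('o, 'm) cat \<Rightarrow> ('o, 'm, 'o, 'm) cfunctor" where
  "id_functor C = \<lparr>Src = C, Tgt = C, fob = (\<lambda>A\<in>Ob C. A), far = (\<lambda>f\<in>Ar C. f)\<rparr>"

definition comp_functor ::
  "('p, 'n, 'q, 'l) cfunctor \<Rightarrow> ('o, 'm, 'p, 'n) cfunctor \<Rightarrow> ('o, 'm, 'q, 'l) cfunctor" where
  "comp_functor G F = \<lparr>Src = Src F, Tgt = Tgt G,
     fob = compose (Ob (Src F)) (fob G) (fob F),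
     far = compose (Ar (Src F)) (far G) (far F)\<rparr>"

text \<open>The category of all categories whose objects and arrows are drawn from two given types.\<close>

definition Cat :: "(('o, 'm) cat, ('o, 'm, 'o, 'm) cfunctor) cat" where
  "Cat = \<lparr>Ob = {C. category C}, Ar = {F. is_functor F}, dm = Src, cd = Tgt,
          ide = id_functor, cmp = comp_functor\<rparr>"

definition product_cat :: "('o, 'm) cat \<Rightarrow> ('p, 'n) cat \<Rightarrow> ('o \<times> 'p, 'm \<times> 'n) cat" where
  "product_cat C D = \<lparr>Ob = Ob C \<times> Ob D, Ar = Ar C \<times> Ar D,
     dm = (\<lambda>(f, g). (dm C f, dm D g)), cd = (\<lambda>(f, g). (cd C f, cd D g)),
     ide = (\<lambda>(A, B). (ide C A, ide D B)),
     cmp = (\<lambda>(f', g') (f, g). (f' \<cdot>\<^bsub>C\<^esub> f, g' \<cdot>\<^bsub>D\<^esub> g))\<rparr>"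

text \<open>An arrow of the slice over \<open>A\<close> is a commutative triangle, recorded with its two legs.\<close>

definition slice :: "('o, 'm) cat \<Rightarrow> 'o \<Rightarrow> ('m, 'm \<times> 'm \<times> 'm) cat" where
  "slice C A = \<lparr>Ob = {f \<in> Ar C. cd C f = A},
     Ar = {(f, g, h). f \<in> Ar C \<and> cd C f = A \<and> g \<in> Ar C \<and> cd C g = A \<and>
                      h \<in> hom C (dm C f) (dm C g) \<and> g \<cdot>\<^bsub>C\<^esub> h = f},
     dm = (\<lambda>(f, g, h). f), cd = (\<lambda>(f, g, h). g),
     ide = (\<lambda>f. (f, f, ide C (dm C f))),
     cmp = (\<lambda>(g', k, h') (f, g, h). (f, k, h' \<cdot>\<^bsub>C\<^esub> h))\<rparr>"


section \<open>Chosen finite limits\<close>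

text \<open>Terminal objects, binary products and pullbacks are arbitrary choices, made with Hilbert's
  operator; a cone is given by its pair of legs, the vertex being their common domain.\<close>

definition is_terminal :: "('o, 'm) cat \<Rightarrow> 'o \<Rightarrow> bool" where
  "is_terminal C I \<longleftrightarrow> I \<in> Ob C \<and> (\<forall>A\<in>Ob C. \<exists>!f. f \<in> hom C A I)"

definition is_product :: "('o, 'm) cat \<Rightarrow> 'o \<Rightarrow> 'o \<Rightarrow> 'm \<times> 'm \<Rightarrow> bool" where
  "is_product C A B = (\<lambda>(p, q). p \<in> hom C (dm C p) A \<and> q \<in> hom C (dm C p) B \<and>
     (\<forall>Z\<in>Ob C. \<forall>f\<in>hom C Z A. \<forall>g\<in>hom C Z B.
        \<exists>!h. h \<in> hom C Z (dm C p) \<and> p \<cdot>\<^bsub>C\<^esub> h = f \<and> q \<cdot>\<^bsub>C\<^esub> h = g))"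

definition is_pullback :: "('o, 'm) cat \<Rightarrow> 'm \<Rightarrow> 'm \<Rightarrow> 'm \<times> 'm \<Rightarrow> bool" where
  "is_pullback C f g = (\<lambda>(p, q). p \<in> hom C (dm C p) (dm C f) \<and> q \<in> hom C (dm C p) (dm C g) \<and>
     f \<cdot>\<^bsub>C\<^esub> p = g \<cdot>\<^bsub>C\<^esub> q \<and>
     (\<forall>Z\<in>Ob C. \<forall>a\<in>hom C Z (dm C f). \<forall>b\<in>hom C Z (dm C g). f \<cdot>\<^bsub>C\<^esub> a = g \<cdot>\<^bsub>C\<^esub> b \<longrightarrow>
        (\<exists>!h. h \<in> hom C Z (dm C p) \<and> p \<cdot>\<^bsub>C\<^esub> h = a \<and> q \<cdot>\<^bsub>C\<^esub> h = b)))"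

definition term_ob :: "('o, 'm) cat \<Rightarrow> 'o" where
  "term_ob C = (SOME I. is_terminal C I)"

definition bang :: "('o, 'm) cat \<Rightarrow> 'o \<Rightarrow> 'm" where
  "bang C A = (THE f. f \<in> hom C A (term_ob C))"

definition pr1 :: "('o, 'm) cat \<Rightarrow> 'o \<Rightarrow> 'o \<Rightarrow> 'm" where
  "pr1 C A B = fst (SOME c. is_product C A B c)"

definition pr2 :: "('o, 'm) cat \<Rightarrow> 'o \<Rightarrow> 'o \<Rightarrow> 'm" where
  "pr2 C A B = snd (SOME c. is_product C A B c)"

definition prd :: "('o, 'm) cat \<Rightarrow> 'o \<Rightarrow> 'o \<Rightarrow> 'o" where
  "prd C A B = dm C (pr1 C A B)"

definition pair :: "('o, 'm) cat \<Rightarrow> 'm \<Rightarrow> 'm \<Rightarrow> 'm" where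
  "pair C f g = (THE h. h \<in> hom C (dm C f) (prd C (cd C f) (cd C g)) \<and>
     pr1 C (cd C f) (cd C g) \<cdot>\<^bsub>C\<^esub> h = f \<and> pr2 C (cd C f) (cd C g) \<cdot>\<^bsub>C\<^esub> h = g)"

definition tens :: "('o, 'm) cat \<Rightarrow> 'm \<Rightarrow> 'm \<Rightarrow> 'm" where
  "tens C f g = pair C (f \<cdot>\<^bsub>C\<^esub> pr1 C (dm C f) (dm C g)) (g \<cdot>\<^bsub>C\<^esub> pr2 C (dm C f) (dm C g))"

definition swap :: "('o, 'm) cat \<Rightarrow> 'o \<Rightarrow> 'o \<Rightarrow> 'm" where
  "swap C A B = pair C (pr2 C A B) (pr1 C A B)"

definition assoc_iso :: "('o, 'm) cat \<Rightarrow> 'o \<Rightarrow> 'o \<Rightarrow> 'o \<Rightarrow> 'm" where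
  "assoc_iso C A B D =
     pair C (pr1 C A B \<cdot>\<^bsub>C\<^esub> pr1 C (prd C A B) D)
            (pair C (pr2 C A B \<cdot>\<^bsub>C\<^esub> pr1 C (prd C A B) D) (pr2 C (prd C A B) D))"

definition pb1 :: "('o, 'm) cat \<Rightarrow> 'm \<Rightarrow> 'm \<Rightarrow> 'm" where
  "pb1 C f g = fst (SOME c. is_pullback C f g c)"

definition pb2 :: "('o, 'm) cat \<Rightarrow> 'm \<Rightarrow> 'm \<Rightarrow> 'm" where
  "pb2 C f g = snd (SOME c. is_pullback C f g c)"

definition pb :: "('o, 'm) cat \<Rightarrow> 'm \<Rightarrow> 'm \<Rightarrow> 'o" where
  "pb C f g = dm C (pb1 C f g)"

definition pb_pair :: "('o, 'm) cat \<Rightarrow> 'm \<Rightarrow> 'm \<Rightarrow> 'm \<Rightarrow> 'm \<Rightarrow> 'm" where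
  "pb_pair C f g a b = (THE h. h \<in> hom C (dm C a) (pb C f g) \<and>
     pb1 C f g \<cdot>\<^bsub>C\<^esub> h = a \<and> pb2 C f g \<cdot>\<^bsub>C\<^esub> h = b)"


section \<open>Locally Cartesian closed categories\<close>

definition is_exponential :: "('o, 'm) cat \<Rightarrow> 'o \<Rightarrow> 'o \<Rightarrow> 'o \<Rightarrow> 'm \<Rightarrow> bool" where
  "is_exponential C A B W ev \<longleftrightarrow> W \<in> Ob C \<and> ev \<in> hom C (prd C W A) B \<and>
     (\<forall>Z\<in>Ob C. \<forall>f\<in>hom C (prd C Z A) B.
        \<exists>!h. h \<in> hom C Z W \<and> ev \<cdot>\<^bsub>C\<^esub> tens C h (ide C A) = f)"

definition cartesian_closed :: "('o, 'm) cat \<Rightarrow> bool" where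
  "cartesian_closed C \<longleftrightarrow> category C \<and> (\<exists>I. is_terminal C I) \<and>
     (\<forall>A\<in>Ob C. \<forall>B\<in>Ob C. \<exists>c. is_product C A B c) \<and>
     (\<forall>A\<in>Ob C. \<forall>B\<in>Ob C. \<exists>W ev. is_exponential C A B W ev)"

definition locally_cartesian_closed :: "('o, 'm) cat \<Rightarrow> bool" where
  "locally_cartesian_closed C \<longleftrightarrow> category C \<and> (\<exists>I. is_terminal C I) \<and>
     (\<forall>A\<in>Ob C. cartesian_closed (slice C A))"


section \<open>Probability monads\<close>

record ('o, 'm) smonad =
  mfun :: "('o, 'm, 'o, 'm) cfunctor"
  eta  :: "'o \<Rightarrow> 'm"
  mu   :: "'o \<Rightarrow> 'm"
  str  :: "'o \<Rightarrow> 'o \<Rightarrow> 'm"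

abbreviation Pob :: "('o, 'm) smonad \<Rightarrow> 'o \<Rightarrow> 'o" where
  "Pob P \<equiv> fob (mfun P)"

abbreviation Par :: "('o, 'm) smonad \<Rightarrow> 'm \<Rightarrow> 'm" where
  "Par P \<equiv> far (mfun P)"

locale is_monad =
  fixes E :: "('o, 'm) cat" (structure) and P :: "('o, 'm) smonad"
  assumes endofunctor: "is_functor (mfun P)" "Src (mfun P) = E" "Tgt (mfun P) = E"
    and eta_hom: "A \<in> Ob E \<Longrightarrow> eta P A \<in> hom E A (Pob P A)"
    and eta_nat: "f \<in> hom E A B \<Longrightarrow> eta P B \<cdot> f = Par P f \<cdot> eta P A"
    and mu_hom: "A \<in> Ob E \<Longrightarrow> mu P A \<in> hom E (Pob P (Pob P A)) (Pob P A)"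
    and mu_nat: "f \<in> hom E A B \<Longrightarrow> mu P B \<cdot> Par P (Par P f) = Par P f \<cdot> mu P A"
    and mu_eta: "A \<in> Ob E \<Longrightarrow> mu P A \<cdot> eta P (Pob P A) = ide E (Pob P A)"
    and mu_Par_eta: "A \<in> Ob E \<Longrightarrow> mu P A \<cdot> Par P (eta P A) = ide E (Pob P A)"
    and mu_mu: "A \<in> Ob E \<Longrightarrow> mu P A \<cdot> mu P (Pob P A) = mu P A \<cdot> Par P (mu P A)"

locale is_strong_monad = is_monad +
  assumes str_hom: "A \<in> Ob E \<Longrightarrow> B \<in> Ob E
      \<Longrightarrow> str P A B \<in> hom E (prd E A (Pob P B)) (Pob P (prd E A B))"
    and str_nat: "f \<in> hom E A A' \<Longrightarrow> g \<in> hom E B B'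
      \<Longrightarrow> str P A' B' \<cdot> tens E f (Par P g) = Par P (tens E f g) \<cdot> str P A B"
    and str_one: "A \<in> Ob E
      \<Longrightarrow> Par P (pr2 E (term_ob E) A) \<cdot> str P (term_ob E) A = pr2 E (term_ob E) (Pob P A)"
    and str_assoc: "A \<in> Ob E \<Longrightarrow> B \<in> Ob E \<Longrightarrow> D \<in> Ob E
      \<Longrightarrow> Par P (assoc_iso E A B D) \<cdot> str P (prd E A B) D
          = str P A (prd E B D) \<cdot> tens E (ide E A) (str P B D) \<cdot> assoc_iso E A B (Pob P D)"
    and str_eta: "A \<in> Ob E \<Longrightarrow> B \<in> Ob E
      \<Longrightarrow> str P A B \<cdot> tens E (ide E A) (eta P B) = eta P (prd E A B)"
    and str_mu: "A \<in> Ob E \<Longrightarrow> B \<in> Ob E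
      \<Longrightarrow> str P A B \<cdot> tens E (ide E A) (mu P B)
          = mu P (prd E A B) \<cdot> Par P (str P A B) \<cdot> str P A (Pob P B)"

definition costr :: "('o, 'm) cat \<Rightarrow> ('o, 'm) smonad \<Rightarrow> 'o \<Rightarrow> 'o \<Rightarrow> 'm" where
  "costr E P A B = Par P (swap E B A) \<cdot>\<^bsub>E\<^esub> str P B A \<cdot>\<^bsub>E\<^esub> swap E (Pob P A) B"

text \<open>A probability monad is a strong monad that is commutative (Fubini: the two ways of forming
  the product of two measures agree) and affine (measures have total mass one).\<close>

locale probability_monad = is_strong_monad +
  assumes commutative: "A \<in> Ob E \<Longrightarrow> B \<in> Ob E
      \<Longrightarrow> mu P (prd E A B) \<cdot> Par P (costr E P A B) \<cdot> str P (Pob P A) B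
          = mu P (prd E A B) \<cdot> Par P (str P A B) \<cdot> costr E P A (Pob P B)"
    and affine: "is_terminal E (Pob P (term_ob E))"


section \<open>Closed dynamical systems\<close>

record ('o, 'm) monoid_obj =
  time :: 'o
  mplus :: 'm
  mzero :: 'm

definition is_monoid_obj :: "('o, 'm) cat \<Rightarrow> ('o, 'm) monoid_obj \<Rightarrow> bool" where
  "is_monoid_obj E M \<longleftrightarrow>
     (let T = time M in
      T \<in> Ob E \<and> mplus M \<in> hom E (prd E T T) T \<and> mzero M \<in> hom E (term_ob E) T \<and>
      mplus M \<cdot>\<^bsub>E\<^esub> pair E (mzero M \<cdot>\<^bsub>E\<^esub> bang E T) (ide E T) = ide E T \<and>
      mplus M \<cdot>\<^bsub>E\<^esub> pair E (ide E T) (mzero M \<cdot>\<^bsub>E\<^esub> bang E T) = ide E T \<and>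
      mplus M \<cdot>\<^bsub>E\<^esub> tens E (mplus M) (ide E T)
        = mplus M \<cdot>\<^bsub>E\<^esub> tens E (ide E T) (mplus M) \<cdot>\<^bsub>E\<^esub> assoc_iso E T T T)"

text \<open>A flow on the state space \<open>X\<close> is taken in its uncurried form \<open>T \<times> X \<rightarrow> X\<close>. Here and below,
  an equation between maps on \<open>X\<close> that holds ``for all \<open>t : T\<close>'' is read internally to \<open>E\<close>, that
  is, as an equation between arrows out of \<open>T \<times> X\<close>.\<close>

definition closed_system :: "('o, 'm) cat \<Rightarrow> ('o, 'm) monoid_obj \<Rightarrow> 'o \<Rightarrow> 'm \<Rightarrow> bool" where
  "closed_system E M X a \<longleftrightarrow>
     (let T = time M in
      X \<in> Ob E \<and> a \<in> hom E (prd E T X) X \<and>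
      a \<cdot>\<^bsub>E\<^esub> pair E (mzero M \<cdot>\<^bsub>E\<^esub> bang E X) (ide E X) = ide E X \<and>
      a \<cdot>\<^bsub>E\<^esub> tens E (mplus M) (ide E X)
        = a \<cdot>\<^bsub>E\<^esub> tens E (ide E T) a \<cdot>\<^bsub>E\<^esub> assoc_iso E T T X)"

definition flow_map ::
  "('o, 'm) cat \<Rightarrow> ('o, 'm) monoid_obj \<Rightarrow> 'o \<Rightarrow> 'm \<Rightarrow> 'o \<Rightarrow> 'm \<Rightarrow> 'm \<Rightarrow> bool" where
  "flow_map E M X a Y b f \<longleftrightarrow>
     f \<in> hom E X Y \<and> f \<cdot>\<^bsub>E\<^esub> a = b \<cdot>\<^bsub>E\<^esub> tens E (ide E (time M)) f"

text \<open>Invariance of a measure \<open>\<beta> : 1 \<rightarrow> P X\<close>: the internal family \<open>P \<theta>(t)\<close>, \<open>t : T\<close>, is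
  \<open>T \<times> P X \<rightarrow> P (T \<times> X) \<rightarrow> P X\<close>, the strength followed by \<open>P\<close> of the flow.\<close>

definition invariant_measure ::
  "('o, 'm) cat \<Rightarrow> ('o, 'm) smonad \<Rightarrow> ('o, 'm) monoid_obj \<Rightarrow> 'o \<Rightarrow> 'm \<Rightarrow> 'm \<Rightarrow> bool" where
  "invariant_measure E P M X a \<beta> \<longleftrightarrow>
     \<beta> \<in> hom E (term_ob E) (Pob P X) \<and>
     Par P a \<cdot>\<^bsub>E\<^esub> str P (time M) X \<cdot>\<^bsub>E\<^esub> tens E (ide E (time M)) \<beta>
       = \<beta> \<cdot>\<^bsub>E\<^esub> pr2 E (time M) (term_ob E)"

type_synonym ('o, 'm) mpsys = "'o \<times> 'm \<times> 'm"

text \<open>\<open>Cat(BT, E)\<^sub>P\<close>: an object is \<open>(\<Omega>, \<theta>, \<beta>)\<close>, with state space, flow and measure.\<close>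

definition MPS :: "('o, 'm) cat \<Rightarrow> ('o, 'm) smonad \<Rightarrow> ('o, 'm) monoid_obj
    \<Rightarrow> (('o, 'm) mpsys, ('o, 'm) mpsys \<times> ('o, 'm) mpsys \<times> 'm) cat" where
  "MPS E P M =
    (let S = {(X, a, \<beta>). closed_system E M X a \<and> invariant_measure E P M X a \<beta>} in
     \<lparr>Ob = S,
      Ar = {((X, a, \<beta>), (X', a', \<beta>'), f). (X, a, \<beta>) \<in> S \<and> (X', a', \<beta>') \<in> S \<and>
              flow_map E M X a X' a' f \<and> Par P f \<cdot>\<^bsub>E\<^esub> \<beta> = \<beta>'},
      dm = (\<lambda>(x, y, f). x), cd = (\<lambda>(x, y, f). y),
      ide = (\<lambda>(X, a, \<beta>). ((X, a, \<beta>), (X, a, \<beta>), ide E X)),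
      cmp = (\<lambda>(y', z, g) (x, y, f). (x, z, g \<cdot>\<^bsub>E\<^esub> f))\<rparr>)"


section \<open>Polynomials\<close>

text \<open>A polynomial is an arrow \<open>p\<close> of \<open>E\<close>, with \<open>p(1) = cd E p\<close> and total space of the fibres
  \<open>dm E p\<close>. For \<open>h : S \<rightarrow> p(1)\<close>, the object \<open>\<Sum>s:S. p[h(s)]\<close> is \<open>pb E h p\<close>, lying over \<open>S\<close> by
  \<open>pb1 E h p\<close>.

  \<open>base_change E p q \<phi>1 \<phi>s h\<close> is \<open>h\<^sup>*\<phi>\<^sup># : \<Sum>s:S. q[\<phi>1 (h s)] \<rightarrow> \<Sum>s:S. p[h s]\<close>, the base change of
  \<open>\<phi>s\<close>, an arrow over \<open>p(1)\<close>, along \<open>h\<close>. Its domain is the chosen pullback of \<open>q\<close> along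
  \<open>\<phi>1 \<circ> h\<close> rather than an iterated pullback; this is why everything below is strictly functorial.\<close>

definition base_change :: "('o, 'm) cat \<Rightarrow> 'm \<Rightarrow> 'm \<Rightarrow> 'm \<Rightarrow> 'm \<Rightarrow> 'm \<Rightarrow> 'm" where
  "base_change E p q \<phi>1 \<phi>s h =
     pb_pair E h p
       (pb1 E (\<phi>1 \<cdot>\<^bsub>E\<^esub> h) q)
       (\<phi>s \<cdot>\<^bsub>E\<^esub> pb_pair E \<phi>1 q (h \<cdot>\<^bsub>E\<^esub> pb1 E (\<phi>1 \<cdot>\<^bsub>E\<^esub> h) q) (pb2 E (\<phi>1 \<cdot>\<^bsub>E\<^esub> h) q))"

definition PolyE :: "('o, 'm) cat \<Rightarrow> ('m, 'm \<times> 'm \<times> 'm \<times> 'm) cat" where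
  "PolyE E =
    \<lparr>Ob = Ar E,
     Ar = {(p, q, \<phi>1, \<phi>s). p \<in> Ar E \<and> q \<in> Ar E \<and> \<phi>1 \<in> hom E (cd E p) (cd E q) \<and>
             \<phi>s \<in> hom E (pb E \<phi>1 q) (dm E p) \<and> p \<cdot>\<^bsub>E\<^esub> \<phi>s = pb1 E \<phi>1 q},
     dm = (\<lambda>(p, q, \<phi>1, \<phi>s). p), cd = (\<lambda>(p, q, \<phi>1, \<phi>s). q),
     ide = (\<lambda>p. (p, p, ide E (cd E p), pb2 E (ide E (cd E p)) p)),
     cmp = (\<lambda>(q', r, \<psi>1, \<psi>s) (p, q, \<phi>1, \<phi>s).
              (p, r, \<psi>1 \<cdot>\<^bsub>E\<^esub> \<phi>1, \<phi>s \<cdot>\<^bsub>E\<^esub> base_change E q r \<psi>1 \<psi>s \<phi>1))\<rparr>"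

definition sections :: "('o, 'm) cat \<Rightarrow> 'm \<Rightarrow> 'm set" where
  "sections E p = {\<sigma> \<in> hom E (cd E p) (dm E p). p \<cdot>\<^bsub>E\<^esub> \<sigma> = ide E (cd E p)}"


section \<open>Open random dynamical systems\<close>

text \<open>The closure of an open system by a section \<open>\<sigma>\<close>, again as a map \<open>T \<times> S \<rightarrow> S\<close>; the second
  factor is the pulled-back section \<open>T \<times> S \<rightarrow> \<Sum>t:T. \<Sum>s:S. p[out(t, s)]\<close>.\<close>

definition closure_by :: "('o, 'm) cat \<Rightarrow> 'm \<Rightarrow> 'm \<Rightarrow> 'm \<Rightarrow> 'm \<Rightarrow> 'm" where
  "closure_by E p out upd \<sigma> =
     upd \<cdot>\<^bsub>E\<^esub> pb_pair E out p (ide E (dm E out)) (\<sigma> \<cdot>\<^bsub>E\<^esub> out)"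

type_synonym 'm ordsys = "'m \<times> 'm \<times> 'm"

text \<open>The state space of \<open>(\<pi>, out, upd)\<close> is \<open>dm E \<pi>\<close>. A morphism is recorded together with its
  source and target.\<close>

definition ord_system ::
  "('o, 'm) cat \<Rightarrow> ('o, 'm) monoid_obj \<Rightarrow> 'm \<Rightarrow> ('o, 'm) mpsys \<Rightarrow> 'm ordsys \<Rightarrow> bool" where
  "ord_system E M p = (\<lambda>(\<Omega>, \<theta>, \<beta>) (\<pi>, out, upd).
     \<pi> \<in> hom E (dm E \<pi>) \<Omega> \<and>
     out \<in> hom E (prd E (time M) (dm E \<pi>)) (cd E p) \<and>
     upd \<in> hom E (pb E out p) (dm E \<pi>) \<and>
     (\<forall>\<sigma>\<in>sections E p.
        closed_system E M (dm E \<pi>) (closure_by E p out upd \<sigma>) \<and>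
        flow_map E M (dm E \<pi>) (closure_by E p out upd \<sigma>) \<Omega> \<theta> \<pi>))"

definition ord_map ::
  "('o, 'm) cat \<Rightarrow> ('o, 'm) monoid_obj \<Rightarrow> 'm \<Rightarrow> 'm ordsys \<Rightarrow> 'm ordsys \<Rightarrow> 'm \<Rightarrow> bool" where
  "ord_map E M p = (\<lambda>(\<pi>X, outX, updX) (\<pi>Y, outY, updY) f.
     f \<in> hom E (dm E \<pi>X) (dm E \<pi>Y) \<and> \<pi>Y \<cdot>\<^bsub>E\<^esub> f = \<pi>X \<and>
     (\<forall>\<sigma>\<in>sections E p.
        flow_map E M (dm E \<pi>X) (closure_by E p outX updX \<sigma>) (dm E \<pi>Y) (closure_by E p outY updY \<sigma>) f))"

definition RDyn :: "('o, 'm) cat \<Rightarrow> ('o, 'm) monoid_obj \<Rightarrow> 'm \<Rightarrow> ('o, 'm) mpsys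
    \<Rightarrow> ('m ordsys, 'm ordsys \<times> 'm ordsys \<times> 'm) cat" where
  "RDyn E M p \<theta> =
    \<lparr>Ob = {x. ord_system E M p \<theta> x},
     Ar = {(x, y, f). ord_system E M p \<theta> x \<and> ord_system E M p \<theta> y \<and> ord_map E M p x y f},
     dm = (\<lambda>(x, y, f). x), cd = (\<lambda>(x, y, f). y),
     ide = (\<lambda>(\<pi>, out, upd). ((\<pi>, out, upd), (\<pi>, out, upd), ide E (dm E \<pi>))),
     cmp = (\<lambda>(y', z, g) (x, y, f). (x, z, g \<cdot>\<^bsub>E\<^esub> f))\<rparr>"

end

theory Submission
  imports Defs
begin

text \<open>Everything rests on one identity between closures. A polynomial map \<open>\<phi> : p \<rightarrow> q\<close> carries a
  section \<open>\<sigma>\<close> of \<open>q\<close> back to the section \<open>i \<mapsto> \<phi>\<^sup>#(i, \<sigma>(\<phi>\<^sub>1(i)))\<close> of \<open>p\<close>, and closing the rewired system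
  by \<open>\<sigma>\<close> gives the same flow as closing the original system by the pulled-back section
  (\<open>closure_by_rewired\<close>). The conditions on an open system over \<open>q\<close>, and on a map between two of
  them, quantify over all closures by sections of \<open>q\<close>; after rewiring they are instances of the
  conditions over \<open>p\<close>. Hence rewiring preserves systems and their maps. Postcomposing the
  projection to the base with a map of closed systems preserves them as well, because maps of flows
  compose. Both operations leave state spaces and underlying maps alone, so functoriality of each
  single reindexing is immediate.

  That the reindexings compose comes down to the base changes \<open>h\<^sup>*\<phi>\<^sup>#\<close>. Evaluated on generalised
  elements (\<open>base_change_pb_pair\<close>), \<open>h\<^sup>*\<phi>\<^sup>#\<close> is \<open>(a, b) \<mapsto> (a, \<phi>\<^sup>#(h(a), b))\<close>, and from this the base
  change of a composite is the composite of the base changes (\<open>base_change_cmp\<close>). Since the domain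
  of \<open>h\<^sup>*\<phi>\<^sup>#\<close> is the chosen pullback along \<open>\<phi>\<^sub>1 \<circ> h\<close>, no comparison isomorphism between iterated
  pullbacks enters, and the indexed category is a strict functor into the category of categories.
  The same identity gives associativity in the category of polynomials.

  Pullbacks exist because they are products in the slices, and binary products are pullbacks over
  the terminal object.\<close>


section \<open>Categories and functors\<close>

context category
begin

lemma cmp_simps [simp]:
  assumes "f \<in> Ar C" "g \<in> Ar C" "cd C f = dm C g"
  shows "g \<cdot> f \<in> Ar C" "dm C (g \<cdot> f) = dm C f" "cd C (g \<cdot> f) = cd C g"
  using cmp_hom[of f "dm C f" "dm C g" g "cd C g"] assms by (auto simp: hom_def)

lemma ide_simps [simp]:
  assumes "A \<in> Ob C"
  shows "ide C A \<in> Ar C" "dm C (ide C A) = A" "cd C (ide C A) = A"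
  using ide_hom[OF assms] by (auto simp: hom_def)

lemma ide_cmp [simp]: "f \<in> Ar C \<Longrightarrow> cd C f = B \<Longrightarrow> ide C B \<cdot> f = f"
  using ide_left[of f "dm C f" "cd C f"] by (auto simp: hom_def)

lemma cmp_ide [simp]: "f \<in> Ar C \<Longrightarrow> dm C f = A \<Longrightarrow> f \<cdot> ide C A = f"
  using ide_right[of f "dm C f" "cd C f"] by (auto simp: hom_def)

lemma cmp_assoc:
  assumes "f \<in> Ar C" "g \<in> Ar C" "h \<in> Ar C" "cd C f = dm C g" "cd C g = dm C h"
  shows "(h \<cdot> g) \<cdot> f = h \<cdot> g \<cdot> f"
  using assoc[of f "dm C f" "cd C f" g "cd C g" h "cd C h"] assms by (auto simp: hom_def)

lemma cmp_assoc_subst: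
  assumes "h \<cdot> g = k" "f \<in> Ar C" "g \<in> Ar C" "h \<in> Ar C" "cd C f = dm C g" "cd C g = dm C h"
  shows "h \<cdot> g \<cdot> f = k \<cdot> f"
  using cmp_assoc[of f g h] assms by simp

declare dm_closed [simp] cd_closed [simp]

end

lemma category_product_cat:
  assumes "category C" "category D"
  shows "category (product_cat C D)"
proof -
  interpret C: category C by fact
  interpret D: category D by fact
  show ?thesis
    by unfold_locales
      (auto simp: product_cat_def hom_def C.cmp_assoc D.cmp_assoc)
qed

text \<open>Both categories of systems in play consist of objects of the base category with extra
  structure, and of base arrows respecting that structure; an arrow carries its source and target,
  since the same base arrow may respect several structures. Such data inherit the category laws
  from the base as soon as the structured arrows contain identities and are closed under
  composition.\<close>

lemma category_of_structured_objects:
  fixes E :: "('o, 'm) cat" and U :: "'s \<Rightarrow> 'o"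
  assumes "category E"
    and U: "\<And>x. x \<in> S \<Longrightarrow> U x \<in> Ob E"
    and H: "\<And>x y f. x \<in> S \<Longrightarrow> y \<in> S \<Longrightarrow> H x y f \<Longrightarrow> f \<in> hom E (U x) (U y)"
    and H_ide: "\<And>x. x \<in> S \<Longrightarrow> H x x (ide E (U x))"
    and H_cmp: "\<And>x y z f g. x \<in> S \<Longrightarrow> y \<in> S \<Longrightarrow> z \<in> S \<Longrightarrow> H x y f \<Longrightarrow> H y z g
                  \<Longrightarrow> H x z (g \<cdot>\<^bsub>E\<^esub> f)"
  shows "category \<lparr>Ob = S, Ar = {(x, y, f). x \<in> S \<and> y \<in> S \<and> H x y f},
           dm = (\<lambda>(x, y, f). x), cd = (\<lambda>(x, y, f). y),
           ide = (\<lambda>x. (x, x, ide E (U x))),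
           cmp = (\<lambda>(y', z, g) (x, y, f). (x, z, g \<cdot>\<^bsub>E\<^esub> f))\<rparr>"
proof -
  interpret E: category E by fact
  have Ar: "f \<in> Ar E" "dm E f = U x" "cd E f = U y" if "x \<in> S" "y \<in> S" "H x y f" for x y f
    using H[OF that] by (auto simp: hom_def)
  show ?thesis
    by unfold_locales (auto simp: hom_def U H_ide H_cmp Ar E.cmp_assoc)
qed

lemma functor_arrow:
  assumes "is_functor F" "f \<in> Ar (Src F)"
  shows "far F f \<in> Ar (Tgt F)" "dm (Tgt F) (far F f) = fob F (dm (Src F) f)"
    "cd (Tgt F) (far F f) = fob F (cd (Src F) f)"
  using is_functor.far_hom[OF assms(1), of f "dm (Src F) f" "cd (Src F) f"] assms(2)
  by (auto simp: hom_def)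

lemma functor_ob: "is_functor F \<Longrightarrow> A \<in> Ob (Src F) \<Longrightarrow> fob F A \<in> Ob (Tgt F)"
  using is_functor.fob_closed by (auto simp: PiE_def Pi_def)

lemma functor_cmp:
  assumes "is_functor F" "f \<in> Ar (Src F)" "g \<in> Ar (Src F)" "cd (Src F) f = dm (Src F) g"
  shows "far F (g \<cdot>\<^bsub>Src F\<^esub> f) = far F g \<cdot>\<^bsub>Tgt F\<^esub> far F f"
  using is_functor.far_cmp[OF assms(1), of f "dm (Src F) f" "cd (Src F) f" g "cd (Src F) g"]
    assms(2-) by (auto simp: hom_def)

lemma is_functor_id: "category C \<Longrightarrow> is_functor (id_functor C)"
proof -
  assume "category C"
  then interpret category C .
  show ?thesis
    by unfold_locales (auto simp: id_functor_def hom_def cmp_assoc)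
qed

lemma is_functor_comp:
  assumes F: "is_functor F" and G: "is_functor G" and FG: "Tgt F = Src G"
  shows "is_functor (comp_functor G F)"
proof -
  interpret S: category "Src F" using F by (rule is_functor.src)
  show ?thesis
  proof (rule is_functor.intro)
    show "category (Src (comp_functor G F))" "category (Tgt (comp_functor G F))"
      using F G by (auto simp: comp_functor_def is_functor.src is_functor.tgt)
    show "fob (comp_functor G F) \<in> Ob (Src (comp_functor G F)) \<rightarrow>\<^sub>E Ob (Tgt (comp_functor G F))"
      using functor_ob[OF F] functor_ob[OF G] FG by (auto simp: comp_functor_def compose_def)
    show "far (comp_functor G F) \<in> extensional (Ar (Src (comp_functor G F)))"
      by (simp add: comp_functor_def)
    show "far (comp_functor G F) f
        \<in> hom (Tgt (comp_functor G F)) (fob (comp_functor G F) A) (fob (comp_functor G F) B)"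
      if "f \<in> hom (Src (comp_functor G F)) A B" for f A B
      using that functor_arrow[OF F] functor_arrow[OF G] FG
      by (auto simp: comp_functor_def compose_def hom_def)
    show "far (comp_functor G F) (ide (Src (comp_functor G F)) A)
        = ide (Tgt (comp_functor G F)) (fob (comp_functor G F) A)"
      if "A \<in> Ob (Src (comp_functor G F))" for A
      using that is_functor.far_ide[OF F] is_functor.far_ide[OF G] functor_ob[OF F] FG
      by (auto simp: comp_functor_def compose_def)
    show "far (comp_functor G F) (g \<cdot>\<^bsub>Src (comp_functor G F)\<^esub> f)
        = far (comp_functor G F) g \<cdot>\<^bsub>Tgt (comp_functor G F)\<^esub> far (comp_functor G F) f"
      if "f \<in> hom (Src (comp_functor G F)) A B" "g \<in> hom (Src (comp_functor G F)) B D"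
      for f g A B D
      using that functor_arrow[OF F] functor_arrow[OF G] functor_cmp[OF F] functor_cmp[OF G] FG
      by (auto simp: comp_functor_def compose_def hom_def)
  qed
qed

text \<open>Pointwise agreement on the source category suffices, since off it the maps of both functors
  are \<open>undefined\<close>.\<close>

lemma functor_eqI:
  assumes F: "is_functor F" and G: "is_functor G"
    and "Src F = Src G" "Tgt F = Tgt G"
    and ob: "\<And>A. A \<in> Ob (Src F) \<Longrightarrow> fob F A = fob G A"
    and ar: "\<And>f. f \<in> Ar (Src F) \<Longrightarrow> far F f = far G f"
  shows "F = G"
proof (rule cfunctor.equality)
  show "fob F = fob G"
    using is_functor.fob_closed[OF F] is_functor.fob_closed[OF G] \<open>Src F = Src G\<close> ob
    by (auto intro!: extensionalityI[of _ "Ob (Src F)"] simp: PiE_def)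
  show "far F = far G"
    using is_functor.far_ext[OF F] is_functor.far_ext[OF G] \<open>Src F = Src G\<close> ar
    by (auto intro!: extensionalityI[of _ "Ar (Src F)"])
qed (use assms in auto)

lemma category_Cat: "category (Cat :: (('o, 'm) cat, ('o, 'm, 'o, 'm) cfunctor) cat)"
proof -
  have ends [simp]: "Src (id_functor C) = C" "Tgt (id_functor C) = C"
    "Src (comp_functor G F) = Src F" "Tgt (comp_functor G F) = Tgt G"
    for C :: "('o, 'm) cat" and F G :: "('o, 'm, 'o, 'm) cfunctor"
    by (auto simp: id_functor_def comp_functor_def)
  have id_left: "comp_functor (id_functor (Tgt F)) F = F" if F: "is_functor F"
    for F :: "('o, 'm, 'o, 'm) cfunctor"
  proof (rule functor_eqI)
    show "is_functor (comp_functor (id_functor (Tgt F)) F)"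
      by (rule is_functor_comp) (auto simp: F is_functor_id is_functor.tgt)
  qed (auto simp: F comp_functor_def id_functor_def compose_def functor_ob functor_arrow)
  have id_right: "comp_functor F (id_functor (Src F)) = F" if F: "is_functor F"
    for F :: "('o, 'm, 'o, 'm) cfunctor"
  proof (rule functor_eqI)
    show "is_functor (comp_functor F (id_functor (Src F)))"
      by (rule is_functor_comp) (auto simp: F is_functor_id is_functor.src)
  qed (auto simp: F comp_functor_def id_functor_def compose_def)
  have comp_assoc: "comp_functor (comp_functor H G) F = comp_functor H (comp_functor G F)"
    if "is_functor F" "is_functor G" "is_functor H" "Tgt F = Src G" "Tgt G = Src H"
    for F G H :: "('o, 'm, 'o, 'm) cfunctor"
  proof (rule functor_eqI)
    show "is_functor (comp_functor (comp_functor H G) F)"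
      "is_functor (comp_functor H (comp_functor G F))"
      using that by (auto intro!: is_functor_comp)
  next
    fix A assume "A \<in> Ob (Src (comp_functor (comp_functor H G) F))"
    then show "fob (comp_functor (comp_functor H G) F) A = fob (comp_functor H (comp_functor G F)) A"
      using that functor_ob[of F A] by (auto simp: comp_functor_def compose_def)
  next
    fix f assume "f \<in> Ar (Src (comp_functor (comp_functor H G) F))"
    then show "far (comp_functor (comp_functor H G) F) f = far (comp_functor H (comp_functor G F)) f"
      using that functor_arrow(1)[of F f] by (auto simp: comp_functor_def compose_def)
  qed auto
  show ?thesis
    by unfold_locales
      (auto simp: Cat_def hom_def is_functor.src is_functor.tgt is_functor_id is_functor_comp
        id_left id_right comp_assoc)
qed


section \<open>Finite limits in a locally Cartesian closed category\<close>

text \<open>A cone over the cospan \<open>(f, g)\<close> is the same as a span from an object of the slice to \<open>f\<close> and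
  \<open>g\<close>, that object being the common composite into \<open>D\<close>. The universal properties therefore match.
  In the slice product, \<open>u\<close> is the vertex, and \<open>a\<close>, \<open>b\<close> are the base arrows of its two legs.\<close>

lemma pullback_from_slice_product:
  fixes C (structure)
  assumes "category C" and f: "f \<in> Ar C" "cd C f = D" and g: "g \<in> Ar C" "cd C g = D"
    and prod: "is_product (slice C D) f g ((u, f', a), (u', g', b))"
  shows "is_pullback C f g (a, b)"
proof -
  interpret category C by fact
  have legs: "f' = f" "g' = g" "u' = u" "u \<in> Ar C" "cd C u = D"
      "a \<in> hom C (dm C u) (dm C f)" "f \<cdot> a = u" "b \<in> hom C (dm C u) (dm C g)" "g \<cdot> b = u"
    using prod by (auto simp: is_product_def slice_def hom_def)
  have univ: "\<exists>!h. h \<in> hom C Z (dm C u) \<and> a \<cdot> h = x \<and> b \<cdot> h = y"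
    if Z: "Z \<in> Ob C" and x: "x \<in> hom C Z (dm C f)" and y: "y \<in> hom C Z (dm C g)"
      and xy: "f \<cdot> x = g \<cdot> y" for Z x y
  proof -
    \<comment> \<open>A commuting cone \<open>(x, y)\<close> is a cone in the slice with vertex \<open>f \<cdot> x\<close>.\<close>
    have z: "f \<cdot> x \<in> Ob (slice C D)" "(f \<cdot> x, f, x) \<in> hom (slice C D) (f \<cdot> x) f"
      "(f \<cdot> x, g, y) \<in> hom (slice C D) (f \<cdot> x) g"
      using x y xy f g by (auto simp: slice_def hom_def)
    then have ex1: "\<exists>!k. k \<in> hom (slice C D) (f \<cdot> x) u
        \<and> (u, f, a) \<cdot>\<^bsub>slice C D\<^esub> k = (f \<cdot> x, f, x) \<and> (u, g, b) \<cdot>\<^bsub>slice C D\<^esub> k = (f \<cdot> x, g, y)"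
      using prod unfolding is_product_def legs by (auto simp: slice_def)
    have lift: "(f \<cdot> x, u, h) \<in> hom (slice C D) (f \<cdot> x) u
        \<and> (u, f, a) \<cdot>\<^bsub>slice C D\<^esub> (f \<cdot> x, u, h) = (f \<cdot> x, f, x)
        \<and> (u, g, b) \<cdot>\<^bsub>slice C D\<^esub> (f \<cdot> x, u, h) = (f \<cdot> x, g, y)"
      if "h \<in> hom C Z (dm C u)" "a \<cdot> h = x" "b \<cdot> h = y" for h
    proof -
      have "u \<cdot> h = f \<cdot> x"
        using cmp_assoc[of h a f] legs that f by (auto simp: hom_def)
      then show ?thesis using that legs x f by (auto simp: slice_def hom_def)
    qed
    from ex1 obtain k where k: "k \<in> hom (slice C D) (f \<cdot> x) u"
      "(u, f, a) \<cdot>\<^bsub>slice C D\<^esub> k = (f \<cdot> x, f, x)" "(u, g, b) \<cdot>\<^bsub>slice C D\<^esub> k = (f \<cdot> x, g, y)"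
      by blast
    then obtain h where h: "h \<in> hom C Z (dm C u)" "a \<cdot> h = x" "b \<cdot> h = y"
      using x f by (cases k) (auto simp: slice_def hom_def)
    show ?thesis
    proof (rule ex1I[of _ h])
      fix h' assume "h' \<in> hom C Z (dm C u) \<and> a \<cdot> h' = x \<and> b \<cdot> h' = y"
      then have "(f \<cdot> x, u, h') = (f \<cdot> x, u, h)"
        using lift[of h'] lift[of h] h ex1 by blast
      then show "h' = h" by simp
    qed (use h in auto)
  qed
  have "dm C a = dm C u" "f \<cdot> a = g \<cdot> b" using legs by (auto simp: hom_def)
  then show ?thesis using legs univ by (auto simp: is_pullback_def)
qed

text \<open>Over a terminal object every square commutes, so the commutation requirement on cones is
  vacuous.\<close>

lemma product_from_pullback_over_terminal:
  fixes C (structure)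
  assumes "category C" and I: "is_terminal C I" and f: "f \<in> hom C A I" and g: "g \<in> hom C B I"
    and pull: "is_pullback C f g (a, b)"
  shows "is_product C A B (a, b)"
proof -
  interpret category C by fact
  have dom: "dm C f = A" "dm C g = B" "f \<in> Ar C" "g \<in> Ar C" "cd C f = I" "cd C g = I"
    using f g by (auto simp: hom_def)
  have "f \<cdot> x = g \<cdot> y" if "Z \<in> Ob C" "x \<in> hom C Z A" "y \<in> hom C Z B" for Z x y
  proof -
    have "f \<cdot> x \<in> hom C Z I" "g \<cdot> y \<in> hom C Z I" using that dom by (auto simp: hom_def)
    then show ?thesis using I that(1) by (auto simp: is_terminal_def)
  qed
  then show ?thesis using pull by (auto simp: is_product_def is_pullback_def dom)
qed

locale lcc_category = category E for E :: "('o, 'm) cat" (structure) +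
  assumes lcc: "locally_cartesian_closed E"
begin

lemma pullback_exists:
  assumes "f \<in> Ar E" "g \<in> Ar E" "cd E f = cd E g"
  shows "\<exists>c. is_pullback E f g c"
proof -
  have "cartesian_closed (slice E (cd E f))"
    using lcc assms by (auto simp: locally_cartesian_closed_def)
  moreover have "f \<in> Ob (slice E (cd E f))" "g \<in> Ob (slice E (cd E f))"
    using assms by (auto simp: slice_def)
  ultimately obtain c where "is_product (slice E (cd E f)) f g c"
    unfolding cartesian_closed_def by blast
  then show ?thesis
    using pullback_from_slice_product[OF category_axioms] assms by (cases c) force
qed

lemma product_exists:
  assumes "A \<in> Ob E" "B \<in> Ob E"
  shows "\<exists>c. is_product E A B c"
proof -
  obtain I where I: "is_terminal E I"
    using lcc by (auto simp: locally_cartesian_closed_def)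
  then obtain f g where fg: "f \<in> hom E A I" "g \<in> hom E B I"
    using assms unfolding is_terminal_def by blast
  then obtain c where "is_pullback E f g c"
    using pullback_exists[of f g] unfolding hom_def by auto
  then show ?thesis
    using product_from_pullback_over_terminal[OF category_axioms I fg] by (cases c) blast
qed

lemma pb_is_pullback:
  assumes "f \<in> Ar E" "g \<in> Ar E" "cd E f = cd E g"
  shows "is_pullback E f g (pb1 E f g, pb2 E f g)"
  unfolding pb1_def pb2_def prod.collapse by (rule someI_ex) (rule pullback_exists[OF assms])

lemma pb_simps [simp]:
  assumes "f \<in> Ar E" "g \<in> Ar E" "cd E f = cd E g"
  shows "pb1 E f g \<in> Ar E" "dm E (pb1 E f g) = pb E f g" "cd E (pb1 E f g) = dm E f"
    "pb2 E f g \<in> Ar E" "dm E (pb2 E f g) = pb E f g" "cd E (pb2 E f g) = dm E g"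
    "pb E f g \<in> Ob E"
  using pb_is_pullback[OF assms] by (auto simp: is_pullback_def hom_def pb_def)

lemma pb_square:
  assumes "f \<in> Ar E" "g \<in> Ar E" "cd E f = cd E g"
  shows "g \<cdot> pb2 E f g = f \<cdot> pb1 E f g"
  using pb_is_pullback[OF assms] by (auto simp: is_pullback_def)

lemma pb_ex1:
  assumes "f \<in> Ar E" "g \<in> Ar E" "cd E f = cd E g"
    and "a \<in> Ar E" "b \<in> Ar E" "dm E a = dm E b" "cd E a = dm E f" "cd E b = dm E g"
    and "f \<cdot> a = g \<cdot> b"
  shows "\<exists>!h. h \<in> hom E (dm E a) (pb E f g) \<and> pb1 E f g \<cdot> h = a \<and> pb2 E f g \<cdot> h = b"
  using pb_is_pullback[OF assms(1-3)] assms(4-)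
  by (auto simp: is_pullback_def hom_def simp flip: pb_def)

lemma pb_pair_simps [simp]:
  assumes "f \<in> Ar E" "g \<in> Ar E" "cd E f = cd E g"
    and "a \<in> Ar E" "b \<in> Ar E" "dm E a = dm E b" "cd E a = dm E f" "cd E b = dm E g"
    and "f \<cdot> a = g \<cdot> b"
  shows "pb_pair E f g a b \<in> Ar E" "dm E (pb_pair E f g a b) = dm E a"
    "cd E (pb_pair E f g a b) = pb E f g"
    "pb1 E f g \<cdot> pb_pair E f g a b = a" "pb2 E f g \<cdot> pb_pair E f g a b = b"
  using theI'[OF pb_ex1[OF assms]] unfolding pb_pair_def[symmetric] by (auto simp: hom_def)

lemma pb_pair_eqI:
  assumes "f \<in> Ar E" "g \<in> Ar E" "cd E f = cd E g" "h \<in> Ar E" "cd E h = pb E f g"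
    and "pb1 E f g \<cdot> h = a" "pb2 E f g \<cdot> h = b"
  shows "pb_pair E f g a b = h"
proof -
  have ab: "a \<in> Ar E" "b \<in> Ar E" "dm E a = dm E h" "dm E b = dm E h"
    "cd E a = dm E f" "cd E b = dm E g"
    using assms by auto
  moreover have "f \<cdot> a = g \<cdot> b"
    using assms pb_square[of f g] cmp_assoc[of h "pb1 E f g" f] cmp_assoc[of h "pb2 E f g" g]
    by auto
  ultimately show ?thesis
    unfolding pb_pair_def
    by (intro the1_equality pb_ex1) (use assms in \<open>auto simp: hom_def\<close>)
qed

lemma pb_pair_cmp:
  assumes "f \<in> Ar E" "g \<in> Ar E" "cd E f = cd E g"
    and "a \<in> Ar E" "b \<in> Ar E" "dm E a = dm E b" "cd E a = dm E f" "cd E b = dm E g"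
    and "f \<cdot> a = g \<cdot> b" and "k \<in> Ar E" "cd E k = dm E a"
  shows "pb_pair E f g a b \<cdot> k = pb_pair E f g (a \<cdot> k) (b \<cdot> k)"
  using assms
  by (intro pb_pair_eqI[symmetric]) (simp_all add: cmp_assoc_subst[OF pb_pair_simps(4)]
      cmp_assoc_subst[OF pb_pair_simps(5)])

lemma pb_pair_legs [simp]:
  assumes "f \<in> Ar E" "g \<in> Ar E" "cd E f = cd E g"
  shows "pb_pair E f g (pb1 E f g) (pb2 E f g) = ide E (pb E f g)"
  by (rule pb_pair_eqI) (use assms in auto)

lemma prd_is_product: "A \<in> Ob E \<Longrightarrow> B \<in> Ob E \<Longrightarrow> is_product E A B (pr1 E A B, pr2 E A B)"
  unfolding pr1_def pr2_def prod.collapse by (rule someI_ex) (rule product_exists)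

lemma pr_simps [simp]:
  assumes "A \<in> Ob E" "B \<in> Ob E"
  shows "pr1 E A B \<in> Ar E" "dm E (pr1 E A B) = prd E A B" "cd E (pr1 E A B) = A"
    "pr2 E A B \<in> Ar E" "dm E (pr2 E A B) = prd E A B" "cd E (pr2 E A B) = B"
    "prd E A B \<in> Ob E"
  using prd_is_product[OF assms] by (auto simp: is_product_def hom_def prd_def)

lemma pair_ex1:
  assumes "f \<in> Ar E" "g \<in> Ar E" "dm E f = dm E g"
  shows "\<exists>!h. h \<in> hom E (dm E f) (prd E (cd E f) (cd E g)) \<and>
     pr1 E (cd E f) (cd E g) \<cdot> h = f \<and> pr2 E (cd E f) (cd E g) \<cdot> h = g"
  using prd_is_product[of "cd E f" "cd E g"] assms
  by (auto simp: is_product_def hom_def simp flip: prd_def)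

lemma pair_simps [simp]:
  assumes "f \<in> Ar E" "g \<in> Ar E" "dm E f = dm E g"
  shows "pair E f g \<in> Ar E" "dm E (pair E f g) = dm E f"
    "cd E (pair E f g) = prd E (cd E f) (cd E g)"
    "pr1 E (cd E f) (cd E g) \<cdot> pair E f g = f" "pr2 E (cd E f) (cd E g) \<cdot> pair E f g = g"
  using theI'[OF pair_ex1[OF assms]] unfolding pair_def[symmetric] by (auto simp: hom_def)

lemma pair_eqI:
  assumes "A \<in> Ob E" "B \<in> Ob E" "h \<in> Ar E" "cd E h = prd E A B"
    and "pr1 E A B \<cdot> h = f" "pr2 E A B \<cdot> h = g"
  shows "pair E f g = h"
proof -
  have "f \<in> Ar E" "g \<in> Ar E" "dm E f = dm E h" "dm E g = dm E h" "cd E f = A" "cd E g = B"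
    using assms by auto
  then show ?thesis
    unfolding pair_def by (intro the1_equality pair_ex1) (use assms in \<open>auto simp: hom_def\<close>)
qed

lemma tens_simps [simp]:
  assumes "f \<in> Ar E" "g \<in> Ar E"
  shows "tens E f g \<in> Ar E" "dm E (tens E f g) = prd E (dm E f) (dm E g)"
    "cd E (tens E f g) = prd E (cd E f) (cd E g)"
    "pr1 E (cd E f) (cd E g) \<cdot> tens E f g = f \<cdot> pr1 E (dm E f) (dm E g)"
    "pr2 E (cd E f) (cd E g) \<cdot> tens E f g = g \<cdot> pr2 E (dm E f) (dm E g)"
  using pair_simps[of "f \<cdot> pr1 E (dm E f) (dm E g)" "g \<cdot> pr2 E (dm E f) (dm E g)"] assms
  by (auto simp: tens_def)

lemma tens_ide: "A \<in> Ob E \<Longrightarrow> B \<in> Ob E \<Longrightarrow> tens E (ide E A) (ide E B) = ide E (prd E A B)"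
  by (simp add: tens_def) (rule pair_eqI, auto)

lemma tens_cmp:
  assumes "f \<in> Ar E" "f' \<in> Ar E" "cd E f = dm E f'" "g \<in> Ar E" "g' \<in> Ar E" "cd E g = dm E g'"
  shows "tens E (f' \<cdot> f) (g' \<cdot> g) = tens E f' g' \<cdot> tens E f g"
proof -
  have 1: "pr1 E (cd E f') (cd E g') \<cdot> tens E f' g' \<cdot> tens E f g
      = f' \<cdot> f \<cdot> pr1 E (dm E f) (dm E g)"
    using assms tens_simps[of f g] cmp_assoc[of "tens E f g" "pr1 E (dm E f') (dm E g')" f']
      cmp_assoc_subst[OF tens_simps(4)[of f' g'], of "tens E f g"]
    by (simp del: tens_simps(4,5))
  have 2: "pr2 E (cd E f') (cd E g') \<cdot> tens E f' g' \<cdot> tens E f g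
      = g' \<cdot> g \<cdot> pr2 E (dm E f) (dm E g)"
    using assms tens_simps[of f g] cmp_assoc[of "tens E f g" "pr2 E (dm E f') (dm E g')" g']
      cmp_assoc_subst[OF tens_simps(5)[of f' g'], of "tens E f g"]
    by (simp del: tens_simps(4,5))
  show ?thesis
    unfolding tens_def[of E "f' \<cdot> f"]
    by (rule pair_eqI[of "cd E f'" "cd E g'"]) (use assms 1 2 in \<open>auto simp: cmp_assoc\<close>)
qed

end


section \<open>The category of polynomials\<close>

context lcc_category
begin

lemma poly_arrow_iff:
  "(p, q, \<phi>1, \<phi>s) \<in> Ar (PolyE E) \<longleftrightarrow>
     p \<in> Ar E \<and> q \<in> Ar E \<and> \<phi>1 \<in> Ar E \<and> dm E \<phi>1 = cd E p \<and> cd E \<phi>1 = cd E q \<and>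
     \<phi>s \<in> Ar E \<and> dm E \<phi>s = pb E \<phi>1 q \<and> cd E \<phi>s = dm E p \<and> p \<cdot> \<phi>s = pb1 E \<phi>1 q"
  by (auto simp: PolyE_def hom_def)

text \<open>The map \<open>\<phi>\<^sup>#\<close> lies over \<open>p(1)\<close>, so \<open>\<phi>\<^sup>#(h(a), b)\<close> lies over \<open>h(a)\<close>. This is the condition under
  which the pair \<open>(a, \<phi>\<^sup>#(h(a), b))\<close> is an element of \<open>h\<^sup>*p\<close>.\<close>

lemma base_change_legs:
  assumes \<phi>: "(p, q, \<phi>1, \<phi>s) \<in> Ar (PolyE E)" and h: "h \<in> Ar E" "cd E h = cd E p"
    and a: "a \<in> Ar E" "b \<in> Ar E" "dm E a = dm E b" "cd E a = dm E h" "cd E b = dm E q"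
      "\<phi>1 \<cdot> h \<cdot> a = q \<cdot> b"
  shows "\<phi>s \<cdot> pb_pair E \<phi>1 q (h \<cdot> a) b \<in> Ar E"
    "dm E (\<phi>s \<cdot> pb_pair E \<phi>1 q (h \<cdot> a) b) = dm E a"
    "cd E (\<phi>s \<cdot> pb_pair E \<phi>1 q (h \<cdot> a) b) = dm E p"
    "p \<cdot> \<phi>s \<cdot> pb_pair E \<phi>1 q (h \<cdot> a) b = h \<cdot> a"
proof -
  note \<phi>' = \<phi>[unfolded poly_arrow_iff]
  then show "\<phi>s \<cdot> pb_pair E \<phi>1 q (h \<cdot> a) b \<in> Ar E"
    "dm E (\<phi>s \<cdot> pb_pair E \<phi>1 q (h \<cdot> a) b) = dm E a"
    "cd E (\<phi>s \<cdot> pb_pair E \<phi>1 q (h \<cdot> a) b) = dm E p"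
    using h a by auto
  show "p \<cdot> \<phi>s \<cdot> pb_pair E \<phi>1 q (h \<cdot> a) b = h \<cdot> a"
    using \<phi>' h a cmp_assoc_subst[of p \<phi>s "pb1 E \<phi>1 q" "pb_pair E \<phi>1 q (h \<cdot> a) b"] by auto
qed

lemma base_change_simps [simp]:
  assumes \<phi>: "(p, q, \<phi>1, \<phi>s) \<in> Ar (PolyE E)" and h: "h \<in> Ar E" "cd E h = cd E p"
  shows "base_change E p q \<phi>1 \<phi>s h \<in> Ar E"
    "dm E (base_change E p q \<phi>1 \<phi>s h) = pb E (\<phi>1 \<cdot> h) q"
    "cd E (base_change E p q \<phi>1 \<phi>s h) = pb E h p"
    "pb1 E h p \<cdot> base_change E p q \<phi>1 \<phi>s h = pb1 E (\<phi>1 \<cdot> h) q"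
proof -
  note \<phi>' = \<phi>[unfolded poly_arrow_iff]
  have ends: "pb1 E (\<phi>1 \<cdot> h) q \<in> Ar E" "pb2 E (\<phi>1 \<cdot> h) q \<in> Ar E"
    "dm E (pb1 E (\<phi>1 \<cdot> h) q) = dm E (pb2 E (\<phi>1 \<cdot> h) q)"
    "cd E (pb1 E (\<phi>1 \<cdot> h) q) = dm E h" "cd E (pb2 E (\<phi>1 \<cdot> h) q) = dm E q"
    "\<phi>1 \<cdot> h \<cdot> pb1 E (\<phi>1 \<cdot> h) q = q \<cdot> pb2 E (\<phi>1 \<cdot> h) q"
    using \<phi>' h by (auto simp: pb_square cmp_assoc)
  note legs = base_change_legs[OF \<phi> h ends]
  show "base_change E p q \<phi>1 \<phi>s h \<in> Ar E"
    "dm E (base_change E p q \<phi>1 \<phi>s h) = pb E (\<phi>1 \<cdot> h) q"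
    "cd E (base_change E p q \<phi>1 \<phi>s h) = pb E h p"
    "pb1 E h p \<cdot> base_change E p q \<phi>1 \<phi>s h = pb1 E (\<phi>1 \<cdot> h) q"
    unfolding base_change_def using \<phi>' h legs by simp_all
qed

text \<open>On generalised elements, \<open>h\<^sup>*\<phi>\<^sup>#\<close> sends \<open>(a, b)\<close>, with \<open>b\<close> in the fibre of \<open>q\<close> over \<open>\<phi>\<^sub>1(h(a))\<close>,
  to \<open>(a, \<phi>\<^sup>#(h(a), b))\<close>. Every identity about base change below is read off from this formula.\<close>

lemma base_change_pb_pair:
  assumes \<phi>: "(p, q, \<phi>1, \<phi>s) \<in> Ar (PolyE E)" and h: "h \<in> Ar E" "cd E h = cd E p"
    and a: "a \<in> Ar E" "b \<in> Ar E" "dm E a = dm E b" "cd E a = dm E h" "cd E b = dm E q"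
      "\<phi>1 \<cdot> h \<cdot> a = q \<cdot> b"
  shows "base_change E p q \<phi>1 \<phi>s h \<cdot> pb_pair E (\<phi>1 \<cdot> h) q a b
      = pb_pair E h p a (\<phi>s \<cdot> pb_pair E \<phi>1 q (h \<cdot> a) b)"
proof -
  note \<phi>' = \<phi>[unfolded poly_arrow_iff]
  define u where "u = pb1 E (\<phi>1 \<cdot> h) q"
  define v where "v = pb2 E (\<phi>1 \<cdot> h) q"
  define m where "m = pb_pair E (\<phi>1 \<cdot> h) q a b"
  have uv: "u \<in> Ar E" "v \<in> Ar E" "dm E u = dm E v" "cd E u = dm E h" "cd E v = dm E q"
    "\<phi>1 \<cdot> h \<cdot> u = q \<cdot> v" and v: "dm E v = pb E (\<phi>1 \<cdot> h) q"
    using \<phi>' h by (auto simp: u_def v_def pb_square cmp_assoc)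
  have m: "m \<in> Ar E" "dm E m = dm E a" "cd E m = pb E (\<phi>1 \<cdot> h) q" "u \<cdot> m = a" "v \<cdot> m = b"
    using \<phi>' h a by (auto simp: cmp_assoc m_def u_def v_def)
  \<comment> \<open>\<open>(u, v)\<close> is the generic element of \<open>(\<phi>\<^sub>1 \<circ> h)\<^sup>*q\<close>; precomposing with \<open>m\<close> specialises it to \<open>(a, b)\<close>.\<close>
  have k: "pb_pair E \<phi>1 q (h \<cdot> u) v \<cdot> m = pb_pair E \<phi>1 q (h \<cdot> a) b"
    using \<phi>' h m(1-3) uv v by (subst pb_pair_cmp) (simp_all add: cmp_assoc m(4,5))
  note legs = base_change_legs[OF \<phi> h uv]
  have "pb_pair E h p u (\<phi>s \<cdot> pb_pair E \<phi>1 q (h \<cdot> u) v) \<cdot> m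
      = pb_pair E h p (u \<cdot> m) ((\<phi>s \<cdot> pb_pair E \<phi>1 q (h \<cdot> u) v) \<cdot> m)"
    by (rule pb_pair_cmp) (use \<phi>' h m(1-3) uv v legs in simp_all)
  also have "(\<phi>s \<cdot> pb_pair E \<phi>1 q (h \<cdot> u) v) \<cdot> m = \<phi>s \<cdot> pb_pair E \<phi>1 q (h \<cdot> a) b"
    unfolding k[symmetric] by (rule cmp_assoc) (use \<phi>' h m(1-3) uv v in simp_all)
  finally show ?thesis
    by (simp add: base_change_def m(4) flip: u_def v_def m_def)
qed

lemma base_change_ide [simp]:
  assumes "p \<in> Ar E" "h \<in> Ar E" "cd E h = cd E p"
  shows "base_change E p p (ide E (cd E p)) (pb2 E (ide E (cd E p)) p) h = ide E (pb E h p)"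
  unfolding base_change_def using assms by (simp add: pb_square)

text \<open>Both sides send \<open>(a, c)\<close> to
  \<open>(a, \<phi>\<^sup>#(h(a), \<psi>\<^sup>#(\<phi>\<^sub>1(h(a)), c)))\<close>. Associativity of composition of polynomial maps and functoriality
  of reindexing both reduce to this.\<close>

lemma base_change_cmp:
  assumes \<phi>: "(p, q, \<phi>1, \<phi>s) \<in> Ar (PolyE E)" and \<psi>: "(q, r, \<psi>1, \<psi>s) \<in> Ar (PolyE E)"
    and h: "h \<in> Ar E" "cd E h = cd E p"
  shows "base_change E p r (\<psi>1 \<cdot> \<phi>1) (\<phi>s \<cdot> base_change E q r \<psi>1 \<psi>s \<phi>1) h
      = base_change E p q \<phi>1 \<phi>s h \<cdot> base_change E q r \<psi>1 \<psi>s (\<phi>1 \<cdot> h)"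
proof -
  note \<phi>' = \<phi>[unfolded poly_arrow_iff] and \<psi>' = \<psi>[unfolded poly_arrow_iff]
  \<comment> \<open>The generic element \<open>(a, c)\<close> of the common domain, and the element \<open>b\<close> of the fibre of \<open>q\<close> over
    \<open>\<phi>\<^sub>1(h(a))\<close> to which \<open>\<psi>\<^sup>#\<close> sends \<open>c\<close>.\<close>
  define a where "a = pb1 E (\<psi>1 \<cdot> \<phi>1 \<cdot> h) r"
  define c where "c = pb2 E (\<psi>1 \<cdot> \<phi>1 \<cdot> h) r"
  define b where "b = \<psi>s \<cdot> pb_pair E \<psi>1 r (\<phi>1 \<cdot> h \<cdot> a) c"
  have ac: "a \<in> Ar E" "c \<in> Ar E" "dm E a = dm E c" "cd E a = dm E h" "cd E c = dm E r"
    "\<psi>1 \<cdot> \<phi>1 \<cdot> h \<cdot> a = r \<cdot> c"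
    using \<phi>' \<psi>' h by (auto simp: a_def c_def pb_square cmp_assoc)
  have b: "b \<in> Ar E" "dm E b = dm E a" "cd E b = dm E q" "q \<cdot> b = \<phi>1 \<cdot> h \<cdot> a"
    using base_change_legs[OF \<psi>, of "\<phi>1 \<cdot> h" a c] \<phi>' \<psi>' h ac by (auto simp: b_def cmp_assoc)
  have "base_change E p q \<phi>1 \<phi>s h \<cdot> base_change E q r \<psi>1 \<psi>s (\<phi>1 \<cdot> h)
      = base_change E p q \<phi>1 \<phi>s h \<cdot> pb_pair E (\<phi>1 \<cdot> h) q a b"
    using \<phi>' \<psi>' h ac by (simp add: base_change_def[of E q] b_def a_def c_def cmp_assoc)
  also have "\<dots> = pb_pair E h p a (\<phi>s \<cdot> pb_pair E \<phi>1 q (h \<cdot> a) b)"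
    using \<phi>' h ac b by (intro base_change_pb_pair[OF \<phi>]) auto
  also have "pb_pair E \<phi>1 q (h \<cdot> a) b
      = base_change E q r \<psi>1 \<psi>s \<phi>1 \<cdot> pb_pair E (\<psi>1 \<cdot> \<phi>1) r (h \<cdot> a) c"
    using \<phi>' \<psi>' h ac by (subst base_change_pb_pair[OF \<psi>]) (auto simp: b_def)
  also have "pb_pair E h p a (\<phi>s \<cdot> \<dots>)
      = base_change E p r (\<psi>1 \<cdot> \<phi>1) (\<phi>s \<cdot> base_change E q r \<psi>1 \<psi>s \<phi>1) h"
    using \<phi>' \<psi>' h ac \<phi> \<psi>
    by (simp add: base_change_def[of E p r] a_def[symmetric] c_def[symmetric] cmp_assoc)
  finally show ?thesis by simp
qed

lemma category_PolyE: "category (PolyE E)"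
proof
  fix p assume "p \<in> Ob (PolyE E)"
  then show "ide (PolyE E) p \<in> hom (PolyE E) p p"
    using pb_square[of "ide E (cd E p)" p] by (auto simp: hom_def PolyE_def)
next
  fix \<phi> \<psi> p q r assume "\<phi> \<in> hom (PolyE E) p q" "\<psi> \<in> hom (PolyE E) q r"
  then obtain \<phi>1 \<phi>s \<psi>1 \<psi>s where eqs: "\<phi> = (p, q, \<phi>1, \<phi>s)" "\<psi> = (q, r, \<psi>1, \<psi>s)"
    and \<phi>: "(p, q, \<phi>1, \<phi>s) \<in> Ar (PolyE E)" and \<psi>: "(q, r, \<psi>1, \<psi>s) \<in> Ar (PolyE E)"
    by (auto simp: hom_def PolyE_def)
  have "p \<cdot> \<phi>s \<cdot> base_change E q r \<psi>1 \<psi>s \<phi>1 = pb1 E (\<psi>1 \<cdot> \<phi>1) r"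
    using \<phi> \<psi> cmp_assoc_subst[of p \<phi>s "pb1 E \<phi>1 q" "base_change E q r \<psi>1 \<psi>s \<phi>1"]
    by (simp add: poly_arrow_iff)
  then have "(p, r, \<psi>1 \<cdot> \<phi>1, \<phi>s \<cdot> base_change E q r \<psi>1 \<psi>s \<phi>1) \<in> Ar (PolyE E)"
    using \<phi> \<psi> by (simp add: poly_arrow_iff)
  then show "\<psi> \<cdot>\<^bsub>PolyE E\<^esub> \<phi> \<in> hom (PolyE E) p r"
    by (simp add: hom_def eqs) (simp add: PolyE_def)
next
  fix \<phi> p q assume "\<phi> \<in> hom (PolyE E) p q"
  then obtain \<phi>1 \<phi>s where eqs: "\<phi> = (p, q, \<phi>1, \<phi>s)" and \<phi>: "(p, q, \<phi>1, \<phi>s) \<in> Ar (PolyE E)"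
    by (auto simp: hom_def PolyE_def)
  note \<phi>' = \<phi>[unfolded poly_arrow_iff]
  show "ide (PolyE E) q \<cdot>\<^bsub>PolyE E\<^esub> \<phi> = \<phi>"
    using \<phi>' by (simp add: PolyE_def eqs)
  have "pb2 E (ide E (cd E p)) p \<cdot> base_change E p q \<phi>1 \<phi>s (ide E (cd E p)) = \<phi>s"
    unfolding base_change_def using \<phi>' by (simp add: pb_square)
  then show "\<phi> \<cdot>\<^bsub>PolyE E\<^esub> ide (PolyE E) p = \<phi>"
    using \<phi>' by (simp add: PolyE_def eqs)
next
  fix \<phi> \<psi> \<chi> p q r s
  assume "\<phi> \<in> hom (PolyE E) p q" "\<psi> \<in> hom (PolyE E) q r" "\<chi> \<in> hom (PolyE E) r s"
  then obtain \<phi>1 \<phi>s \<psi>1 \<psi>s \<chi>1 \<chi>s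
    where eqs: "\<phi> = (p, q, \<phi>1, \<phi>s)" "\<psi> = (q, r, \<psi>1, \<psi>s)" "\<chi> = (r, s, \<chi>1, \<chi>s)"
    and \<phi>: "(p, q, \<phi>1, \<phi>s) \<in> Ar (PolyE E)" and \<psi>: "(q, r, \<psi>1, \<psi>s) \<in> Ar (PolyE E)"
    and \<chi>: "(r, s, \<chi>1, \<chi>s) \<in> Ar (PolyE E)"
    by (auto simp: hom_def PolyE_def)
  have "base_change E q s (\<chi>1 \<cdot> \<psi>1) (\<psi>s \<cdot> base_change E r s \<chi>1 \<chi>s \<psi>1) \<phi>1
      = base_change E q r \<psi>1 \<psi>s \<phi>1 \<cdot> base_change E r s \<chi>1 \<chi>s (\<psi>1 \<cdot> \<phi>1)"
    using \<phi> by (intro base_change_cmp[OF \<psi> \<chi>]) (auto simp: poly_arrow_iff)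
  then show "(\<chi> \<cdot>\<^bsub>PolyE E\<^esub> \<psi>) \<cdot>\<^bsub>PolyE E\<^esub> \<phi> = \<chi> \<cdot>\<^bsub>PolyE E\<^esub> \<psi> \<cdot>\<^bsub>PolyE E\<^esub> \<phi>"
    using \<phi> \<psi> \<chi> base_change_simps[OF \<psi>, of \<phi>1] base_change_simps[OF \<chi>, of "\<psi>1 \<cdot> \<phi>1"]
    by (simp add: eqs PolyE_def poly_arrow_iff[unfolded PolyE_def, simplified] cmp_assoc)
qed (auto simp: PolyE_def hom_def)

end


section \<open>Closed systems and their morphisms\<close>

locale timed_category = lcc_category E
  for E :: "('o, 'm) cat" (structure) and M :: "('o, 'm) monoid_obj" +
  assumes time_ob [simp]: "time M \<in> Ob E"
begin

lemma closed_system_typed: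
  assumes "closed_system E M X a"
  shows "X \<in> Ob E" "a \<in> hom E (prd E (time M) X) X"
  using assms by (auto simp: closed_system_def Let_def)

lemma flow_map_ide:
  assumes "closed_system E M X a"
  shows "flow_map E M X a X a (ide E X)"
  using closed_system_typed[OF assms] by (simp add: flow_map_def hom_def tens_ide)

text \<open>Two equivariance squares are pasted, the time factor being the identity throughout.\<close>

lemma flow_map_cmp:
  assumes "closed_system E M X a" "closed_system E M Y b" "closed_system E M Z c"
    and f: "flow_map E M X a Y b f" and g: "flow_map E M Y b Z c g"
  shows "flow_map E M X a Z c (g \<cdot> f)"
proof -
  note ty = closed_system_typed[OF assms(1)] closed_system_typed[OF assms(2)]
    closed_system_typed[OF assms(3)]
  have fg: "f \<in> hom E X Y" "g \<in> hom E Y Z"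
    "f \<cdot> a = b \<cdot> tens E (ide E (time M)) f" "g \<cdot> b = c \<cdot> tens E (ide E (time M)) g"
    using f g by (auto simp: flow_map_def)
  have "(g \<cdot> f) \<cdot> a = g \<cdot> b \<cdot> tens E (ide E (time M)) f"
    using ty fg by (auto simp: hom_def cmp_assoc)
  also have "\<dots> = c \<cdot> tens E (ide E (time M)) g \<cdot> tens E (ide E (time M)) f"
    using ty fg cmp_assoc_subst[OF fg(4), of "tens E (ide E (time M)) f"]
    by (auto simp: hom_def cmp_assoc)
  also have "tens E (ide E (time M)) g \<cdot> tens E (ide E (time M)) f
      = tens E (ide E (time M)) (g \<cdot> f)"
    using fg tens_cmp[of "ide E (time M)" "ide E (time M)" f g] by (auto simp: hom_def)
  finally show ?thesis using fg by (auto simp: flow_map_def hom_def)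
qed

lemma category_MPS:
  assumes "is_monad E P"
  shows "category (MPS E P M)"
proof -
  interpret P: is_monad E P by fact
  have far_ide: "Par P (ide E A) = ide E (Pob P A)" if "A \<in> Ob E" for A
    using is_functor.far_ide[OF P.endofunctor(1)] P.endofunctor that by simp
  have far_cmp: "Par P (g \<cdot> f) = Par P g \<cdot> Par P f" if "f \<in> hom E A B" "g \<in> hom E B D" for f g A B D
    using is_functor.far_cmp[OF P.endofunctor(1)] P.endofunctor that by simp
  have far_hom: "Par P f \<in> hom E (Pob P A) (Pob P B)" if "f \<in> hom E A B" for f A B
    using is_functor.far_hom[OF P.endofunctor(1)] P.endofunctor that by simp
  let ?S = "{(X, a, \<beta>). closed_system E M X a \<and> invariant_measure E P M X a \<beta>}"
  let ?H = "\<lambda>(X, a, \<beta>) (X', a', \<beta>') f. flow_map E M X a X' a' f \<and> Par P f \<cdot> \<beta> = \<beta>'"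
  have "category \<lparr>Ob = ?S, Ar = {(x, y, f). x \<in> ?S \<and> y \<in> ?S \<and> ?H x y f},
           dm = (\<lambda>(x, y, f). x), cd = (\<lambda>(x, y, f). y),
           ide = (\<lambda>x. (x, x, ide E (fst x))),
           cmp = (\<lambda>(y', z, g) (x, y, f). (x, z, g \<cdot> f))\<rparr>"
  proof (rule category_of_structured_objects[OF category_axioms])
    fix x assume "x \<in> ?S"
    then show "?H x x (ide E (fst x))"
      using flow_map_ide closed_system_typed
      by (auto simp: far_ide invariant_measure_def hom_def)
  next
    fix x y z f g assume S: "x \<in> ?S" "y \<in> ?S" "z \<in> ?S" and H: "?H x y f" "?H y z g"
    obtain X a \<beta> Y b \<gamma> Z c \<delta> where eqs: "x = (X, a, \<beta>)" "y = (Y, b, \<gamma>)" "z = (Z, c, \<delta>)"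
      by (metis prod_cases3)
    have fg: "f \<in> hom E X Y" "g \<in> hom E Y Z" "Par P f \<cdot> \<beta> = \<gamma>" "Par P g \<cdot> \<gamma> = \<delta>"
      "\<beta> \<in> hom E (term_ob E) (Pob P X)"
      using S H by (auto simp: eqs flow_map_def invariant_measure_def)
    have "Par P (g \<cdot> f) \<cdot> \<beta> = \<delta>"
      using fg far_hom[OF fg(1)] far_hom[OF fg(2)] far_cmp[OF fg(1,2)]
      by (auto simp: hom_def cmp_assoc)
    then show "?H x z (g \<cdot> f)"
      using S H flow_map_cmp[of X a Y b Z c f g] by (auto simp: eqs)
  qed (auto simp: closed_system_typed flow_map_def)
  also have "\<lparr>Ob = ?S, Ar = {(x, y, f). x \<in> ?S \<and> y \<in> ?S \<and> ?H x y f},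
           dm = (\<lambda>(x, y, f). x), cd = (\<lambda>(x, y, f). y),
           ide = (\<lambda>x. (x, x, ide E (fst x))),
           cmp = (\<lambda>(y', z, g) (x, y, f). (x, z, g \<cdot> f))\<rparr> = MPS E P M"
    by (auto simp: MPS_def Let_def fun_eq_iff)
  finally show ?thesis .
qed


section \<open>Open random systems\<close>

lemma category_RDyn: "category (RDyn E M p \<theta>)"
proof -
  let ?S = "{x. ord_system E M p \<theta> x}"
  let ?U = "\<lambda>(\<pi>, out, upd). dm E \<pi>"
  have "category \<lparr>Ob = ?S, Ar = {(x, y, f). x \<in> ?S \<and> y \<in> ?S \<and> ord_map E M p x y f},
           dm = (\<lambda>(x, y, f). x), cd = (\<lambda>(x, y, f). y),
           ide = (\<lambda>x. (x, x, ide E (?U x))),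
           cmp = (\<lambda>(y', z, g) (x, y, f). (x, z, g \<cdot> f))\<rparr>"
  proof (rule category_of_structured_objects[OF category_axioms])
    fix x assume "x \<in> ?S"
    then show "ord_map E M p x x (ide E (?U x))"
      using flow_map_ide by (cases \<theta>) (auto simp: ord_system_def ord_map_def hom_def)
  next
    fix x y z f g
    assume S: "x \<in> ?S" "y \<in> ?S" "z \<in> ?S" and H: "ord_map E M p x y f" "ord_map E M p y z g"
    obtain \<pi>x ox ux \<pi>y oy uy \<pi>z oz uz
      where eqs: "x = (\<pi>x, ox, ux)" "y = (\<pi>y, oy, uy)" "z = (\<pi>z, oz, uz)"
      by (metis prod_cases3)
    have \<pi>: "\<pi>z \<in> Ar E" "f \<in> hom E (dm E \<pi>x) (dm E \<pi>y)" "g \<in> hom E (dm E \<pi>y) (dm E \<pi>z)"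
      "\<pi>z \<cdot> g = \<pi>y" "\<pi>y \<cdot> f = \<pi>x"
      using S(3) H by (auto simp: eqs ord_system_def ord_map_def hom_def split: prod.splits)
    then have "\<pi>z \<cdot> g \<cdot> f = \<pi>x"
      using cmp_assoc[of f g \<pi>z] by (simp add: hom_def)
    moreover have "flow_map E M (dm E \<pi>x) (closure_by E p ox ux \<sigma>)
        (dm E \<pi>z) (closure_by E p oz uz \<sigma>) (g \<cdot> f)" if "\<sigma> \<in> sections E p" for \<sigma>
    proof (rule flow_map_cmp)
      show "closed_system E M (dm E \<pi>x) (closure_by E p ox ux \<sigma>)"
        "closed_system E M (dm E \<pi>y) (closure_by E p oy uy \<sigma>)"
        "closed_system E M (dm E \<pi>z) (closure_by E p oz uz \<sigma>)"
        using S that by (auto simp: eqs ord_system_def split: prod.splits)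
      show "flow_map E M (dm E \<pi>x) (closure_by E p ox ux \<sigma>) (dm E \<pi>y) (closure_by E p oy uy \<sigma>) f"
        "flow_map E M (dm E \<pi>y) (closure_by E p oy uy \<sigma>) (dm E \<pi>z) (closure_by E p oz uz \<sigma>) g"
        using H that by (auto simp: eqs ord_map_def)
    qed
    ultimately show "ord_map E M p x z (g \<cdot> f)"
      using \<pi>(2,3) by (simp add: eqs ord_map_def hom_def)
  qed (auto simp: ord_system_def ord_map_def hom_def)
  also have "\<lparr>Ob = ?S, Ar = {(x, y, f). x \<in> ?S \<and> y \<in> ?S \<and> ord_map E M p x y f},
           dm = (\<lambda>(x, y, f). x), cd = (\<lambda>(x, y, f). y),
           ide = (\<lambda>x. (x, x, ide E (?U x))),
           cmp = (\<lambda>(y', z, g) (x, y, f). (x, z, g \<cdot> f))\<rparr> = RDyn E M p \<theta>"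
    by (auto simp: RDyn_def fun_eq_iff)
  finally show ?thesis .
qed

lemma pulled_back_section:
  assumes \<phi>: "(p, q, \<phi>1, \<phi>s) \<in> Ar (PolyE E)" and \<sigma>: "\<sigma> \<in> sections E q"
  shows "\<phi>s \<cdot> pb_pair E \<phi>1 q (ide E (cd E p)) (\<sigma> \<cdot> \<phi>1) \<in> sections E p"
proof -
  note \<phi>' = \<phi>[unfolded poly_arrow_iff]
  have \<sigma>': "\<sigma> \<in> Ar E" "dm E \<sigma> = cd E q" "cd E \<sigma> = dm E q" "q \<cdot> \<sigma> = ide E (cd E q)"
    using \<sigma> by (auto simp: sections_def hom_def)
  have "q \<cdot> \<sigma> \<cdot> \<phi>1 = \<phi>1"
    using \<phi>' \<sigma>' cmp_assoc_subst[OF \<sigma>'(4), of \<phi>1] by simp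
  then show ?thesis
    using base_change_legs[OF \<phi>, of "ide E (cd E p)" "ide E (cd E p)" "\<sigma> \<cdot> \<phi>1"] \<phi>' \<sigma>'
    by (simp add: sections_def hom_def)
qed

text \<open>At state \<open>s\<close> and time \<open>t\<close>, with output \<open>i = out(t, s)\<close>, the rewired system receives the input
  \<open>\<sigma>(\<phi>\<^sub>1(i))\<close>, which \<open>\<phi>\<^sup>#\<close> translates to \<open>\<phi>\<^sup>#(i, \<sigma>(\<phi>\<^sub>1(i)))\<close> before the update. The original system
  closed by the pulled-back section receives that same input. So every condition imposed on the closures of the rewired system
  is already among those imposed on the closures of the original.\<close>

lemma closure_by_rewired:
  assumes \<phi>: "(p, q, \<phi>1, \<phi>s) \<in> Ar (PolyE E)" and \<sigma>: "\<sigma> \<in> sections E q"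
    and out: "out \<in> Ar E" "cd E out = cd E p" and upd: "upd \<in> Ar E" "dm E upd = pb E out p"
  shows "closure_by E q (\<phi>1 \<cdot> out) (upd \<cdot> base_change E p q \<phi>1 \<phi>s out) \<sigma>
      = closure_by E p out upd (\<phi>s \<cdot> pb_pair E \<phi>1 q (ide E (cd E p)) (\<sigma> \<cdot> \<phi>1))"
proof -
  note \<phi>' = \<phi>[unfolded poly_arrow_iff]
  have \<sigma>': "\<sigma> \<in> Ar E" "dm E \<sigma> = cd E q" "cd E \<sigma> = dm E q" "q \<cdot> \<sigma> = ide E (cd E q)"
    using \<sigma> by (auto simp: sections_def hom_def)
  have q\<sigma>: "q \<cdot> \<sigma> \<cdot> k = k" if "k \<in> Ar E" "cd E k = cd E q" for k
    using \<phi>' \<sigma>' that cmp_assoc_subst[OF \<sigma>'(4), of k] by simp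
  have "base_change E p q \<phi>1 \<phi>s out
        \<cdot> pb_pair E (\<phi>1 \<cdot> out) q (ide E (dm E out)) (\<sigma> \<cdot> \<phi>1 \<cdot> out)
      = pb_pair E out p (ide E (dm E out)) (\<phi>s \<cdot> pb_pair E \<phi>1 q out (\<sigma> \<cdot> \<phi>1 \<cdot> out))"
    using \<phi>' \<sigma>' out q\<sigma> by (subst base_change_pb_pair[OF \<phi>]) auto
  also have "pb_pair E \<phi>1 q out (\<sigma> \<cdot> \<phi>1 \<cdot> out)
      = pb_pair E \<phi>1 q (ide E (cd E p)) (\<sigma> \<cdot> \<phi>1) \<cdot> out"
    using \<phi>' \<sigma>' out q\<sigma> by (subst pb_pair_cmp) (auto simp: cmp_assoc)
  finally show ?thesis
    unfolding closure_by_def using \<phi>' \<sigma>' out upd q\<sigma> \<phi> by (simp add: cmp_assoc)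
qed

lemma MPS_arrow:
  assumes "(\<theta>, \<theta>', f) \<in> Ar (MPS E P M)"
  obtains \<Omega> a \<beta> \<Omega>' a' \<beta>' where "\<theta> = (\<Omega>, a, \<beta>)" "\<theta>' = (\<Omega>', a', \<beta>')"
    "closed_system E M \<Omega> a" "closed_system E M \<Omega>' a'" "flow_map E M \<Omega> a \<Omega>' a' f"
  using assms by (cases \<theta>, cases \<theta>') (auto simp: MPS_def Let_def)


section \<open>Reindexing open random systems\<close>

text \<open>Rewiring along a polynomial map changes the last two components, postcomposition with a map
  of base systems only the first; one formula thus covers an arbitrary arrow of the product
  category, and the two actions of the theorem are its cases with an identity in one factor.\<close>

definition rewire :: "'m \<times> 'm \<times> 'm \<times> 'm \<Rightarrow> 'm \<Rightarrow> 'm ordsys \<Rightarrow> 'm ordsys" where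
  "rewire = (\<lambda>(p, q, \<phi>1, \<phi>s) f (\<pi>, out, upd).
     (f \<cdot> \<pi>, \<phi>1 \<cdot> out, upd \<cdot> base_change E p q \<phi>1 \<phi>s out))"

lemma rewire_typed:
  assumes "(p, q, \<phi>1, \<phi>s) \<in> Ar (PolyE E)" "(\<theta>, \<theta>', f) \<in> Ar (MPS E P M)"
    and "ord_system E M p \<theta> (\<pi>, out, upd)"
  shows "\<pi> \<in> Ar E" "f \<in> Ar E" "cd E \<pi> = dm E f" "dm E (f \<cdot> \<pi>) = dm E \<pi>"
    "out \<in> Ar E" "cd E out = cd E p" "dm E out = prd E (time M) (dm E \<pi>)"
    "upd \<in> Ar E" "dm E upd = pb E out p" "cd E upd = dm E \<pi>"
proof -
  show "\<pi> \<in> Ar E" "f \<in> Ar E" "cd E \<pi> = dm E f"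
    "out \<in> Ar E" "cd E out = cd E p" "dm E out = prd E (time M) (dm E \<pi>)"
    "upd \<in> Ar E" "dm E upd = pb E out p" "cd E upd = dm E \<pi>"
    using assms(3) by (auto intro: MPS_arrow[OF assms(2)] simp: ord_system_def flow_map_def hom_def)
  then show "dm E (f \<cdot> \<pi>) = dm E \<pi>" by simp
qed

lemma closure_by_rewire:
  assumes \<phi>: "(p, q, \<phi>1, \<phi>s) \<in> Ar (PolyE E)" and f: "(\<theta>, \<theta>', f) \<in> Ar (MPS E P M)"
    and x: "ord_system E M p \<theta> (\<pi>, out, upd)" and \<sigma>: "\<sigma> \<in> sections E q"
  shows "closure_by E q (\<phi>1 \<cdot> out) (upd \<cdot> base_change E p q \<phi>1 \<phi>s out) \<sigma>
      = closure_by E p out upd (\<phi>s \<cdot> pb_pair E \<phi>1 q (ide E (cd E p)) (\<sigma> \<cdot> \<phi>1))"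
  using rewire_typed[OF \<phi> f x] by (intro closure_by_rewired[OF \<phi> \<sigma>])

text \<open>Each closure of the rewired system is a closure of the original one, which projects to the
  old base system; composing with \<open>f\<close> projects it on to the new one.\<close>

lemma rewire_system:
  assumes \<phi>: "(p, q, \<phi>1, \<phi>s) \<in> Ar (PolyE E)" and f: "(\<theta>, \<theta>', f) \<in> Ar (MPS E P M)"
    and x: "ord_system E M p \<theta> x"
  shows "ord_system E M q \<theta>' (rewire (p, q, \<phi>1, \<phi>s) f x)"
proof -
  obtain \<pi> out upd where x_eq: "x = (\<pi>, out, upd)" by (cases x)
  obtain \<Omega> a \<beta> \<Omega>' a' \<beta>' where \<theta>: "\<theta> = (\<Omega>, a, \<beta>)" "\<theta>' = (\<Omega>', a', \<beta>')"
    "closed_system E M \<Omega> a" "closed_system E M \<Omega>' a'" "flow_map E M \<Omega> a \<Omega>' a' f"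
    using f by (rule MPS_arrow)
  note x' = x[unfolded x_eq]
  note ty = rewire_typed[OF \<phi> f x']
  note \<phi>' = \<phi>[unfolded poly_arrow_iff]
  have "closed_system E M (dm E \<pi>) (closure_by E q (\<phi>1 \<cdot> out) (upd \<cdot> base_change E p q \<phi>1 \<phi>s out) \<sigma>)
      \<and> flow_map E M (dm E \<pi>) (closure_by E q (\<phi>1 \<cdot> out) (upd \<cdot> base_change E p q \<phi>1 \<phi>s out) \<sigma>)
          \<Omega>' a' (f \<cdot> \<pi>)"
    if \<sigma>: "\<sigma> \<in> sections E q" for \<sigma>
  proof -
    let ?\<tau> = "\<phi>s \<cdot> pb_pair E \<phi>1 q (ide E (cd E p)) (\<sigma> \<cdot> \<phi>1)"
    have "closed_system E M (dm E \<pi>) (closure_by E p out upd ?\<tau>)"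
      "flow_map E M (dm E \<pi>) (closure_by E p out upd ?\<tau>) \<Omega> a \<pi>"
      using x' pulled_back_section[OF \<phi> \<sigma>] by (auto simp: ord_system_def \<theta>)
    then show ?thesis
      unfolding closure_by_rewire[OF \<phi> f x' \<sigma>] using flow_map_cmp \<theta>(3-5) by blast
  qed
  moreover have "cd E f = \<Omega>'" using \<theta>(5) by (simp add: flow_map_def hom_def)
  ultimately show ?thesis
    using ty \<phi>' base_change_simps[OF \<phi> ty(5,6)]
    by (simp add: x_eq rewire_def ord_system_def \<theta>(2) hom_def)
qed

lemma rewire_map:
  assumes \<phi>: "(p, q, \<phi>1, \<phi>s) \<in> Ar (PolyE E)" and f: "(\<theta>, \<theta>', f) \<in> Ar (MPS E P M)"
    and x: "ord_system E M p \<theta> x" and y: "ord_system E M p \<theta> y" and g: "ord_map E M p x y g"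
  shows "ord_map E M q (rewire (p, q, \<phi>1, \<phi>s) f x) (rewire (p, q, \<phi>1, \<phi>s) f y) g"
proof -
  obtain \<pi> out upd \<pi>' out' upd' where eqs: "x = (\<pi>, out, upd)" "y = (\<pi>', out', upd')"
    by (cases x, cases y)
  note ty = rewire_typed[OF \<phi> f x[unfolded eqs]] rewire_typed[OF \<phi> f y[unfolded eqs]]
  have g': "g \<in> hom E (dm E \<pi>) (dm E \<pi>')" "\<pi>' \<cdot> g = \<pi>"
    using g by (auto simp: eqs ord_map_def)
  then have "(f \<cdot> \<pi>') \<cdot> g = f \<cdot> \<pi>"
    using ty cmp_assoc[of g \<pi>' f] by (simp add: hom_def)
  then show ?thesis
    using g g' ty(4,14) pulled_back_section[OF \<phi>]
    by (simp add: eqs rewire_def ord_map_def closure_by_rewire[OF \<phi> f x[unfolded eqs]]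
        closure_by_rewire[OF \<phi> f y[unfolded eqs]])
qed

lemma rewire_ide:
  assumes "p \<in> Ar E" "ord_system E M p (\<Omega>, a, \<beta>) x"
  shows "rewire (ide (PolyE E) p) (ide E \<Omega>) x = x"
  using assms by (cases x) (auto simp: rewire_def PolyE_def ord_system_def hom_def)

lemma rewire_cmp:
  assumes \<phi>: "(p, q, \<phi>1, \<phi>s) \<in> Ar (PolyE E)" and f: "(\<theta>, \<theta>', f) \<in> Ar (MPS E P M)"
    and \<psi>: "(q, r, \<psi>1, \<psi>s) \<in> Ar (PolyE E)" and g: "(\<theta>', \<theta>'', g) \<in> Ar (MPS E P M)"
    and x: "ord_system E M p \<theta> x"
  shows "rewire ((q, r, \<psi>1, \<psi>s) \<cdot>\<^bsub>PolyE E\<^esub> (p, q, \<phi>1, \<phi>s)) (g \<cdot> f) x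
      = rewire (q, r, \<psi>1, \<psi>s) g (rewire (p, q, \<phi>1, \<phi>s) f x)"
proof -
  obtain \<pi> out upd where x_eq: "x = (\<pi>, out, upd)" by (cases x)
  note ty = rewire_typed[OF \<phi> f x[unfolded x_eq]]
  note \<phi>' = \<phi>[unfolded poly_arrow_iff] and \<psi>' = \<psi>[unfolded poly_arrow_iff]
  have fg: "g \<in> Ar E" "cd E f = dm E g"
    using f g by (auto elim!: MPS_arrow simp: flow_map_def hom_def)
  \<comment> \<open>Strictness of the composition law: the update maps agree on the nose.\<close>
  have bc: "base_change E p r (\<psi>1 \<cdot> \<phi>1) (\<phi>s \<cdot> base_change E q r \<psi>1 \<psi>s \<phi>1) out
      = base_change E p q \<phi>1 \<phi>s out \<cdot> base_change E q r \<psi>1 \<psi>s (\<phi>1 \<cdot> out)"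
    using ty by (intro base_change_cmp[OF \<phi> \<psi>])
  show ?thesis
    using ty fg \<phi>' \<psi>' base_change_simps[OF \<phi> ty(5,6)] base_change_simps[OF \<psi>, of "\<phi>1 \<cdot> out"]
    by (simp add: x_eq rewire_def PolyE_def bc cmp_assoc)
qed

definition reindex_functor ::
  "('m \<times> 'm \<times> 'm \<times> 'm) \<times> ('o, 'm) mpsys \<times> ('o, 'm) mpsys \<times> 'm
    \<Rightarrow> ('m ordsys, 'm ordsys \<times> 'm ordsys \<times> 'm, 'm ordsys, 'm ordsys \<times> 'm ordsys \<times> 'm) cfunctor"
  where
  "reindex_functor = (\<lambda>(\<phi>, \<theta>, \<theta>', f).
     let C = RDyn E M (dm (PolyE E) \<phi>) \<theta> in
     \<lparr>Src = C, Tgt = RDyn E M (cd (PolyE E) \<phi>) \<theta>',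
      fob = restrict (rewire \<phi> f) (Ob C),
      far = (\<lambda>(x, y, g)\<in>Ar C. (rewire \<phi> f x, rewire \<phi> f y, g))\<rparr>)"

lemma reindex_functor_simps [simp]:
  "Src (reindex_functor ((p, q, \<phi>1, \<phi>s), \<theta>, \<theta>', f)) = RDyn E M p \<theta>"
  "Tgt (reindex_functor ((p, q, \<phi>1, \<phi>s), \<theta>, \<theta>', f)) = RDyn E M q \<theta>'"
  "fob (reindex_functor ((p, q, \<phi>1, \<phi>s), \<theta>, \<theta>', f))
     = restrict (rewire (p, q, \<phi>1, \<phi>s) f) (Ob (RDyn E M p \<theta>))"
  "far (reindex_functor ((p, q, \<phi>1, \<phi>s), \<theta>, \<theta>', f))
     = (\<lambda>(x, y, g)\<in>Ar (RDyn E M p \<theta>).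
          (rewire (p, q, \<phi>1, \<phi>s) f x, rewire (p, q, \<phi>1, \<phi>s) f y, g))"
  by (simp_all add: reindex_functor_def Let_def PolyE_def)

lemma RDyn_simps:
  "x \<in> Ob (RDyn E M p \<theta>) \<longleftrightarrow> ord_system E M p \<theta> x"
  "(x, y, g) \<in> Ar (RDyn E M p \<theta>) \<longleftrightarrow>
     ord_system E M p \<theta> x \<and> ord_system E M p \<theta> y \<and> ord_map E M p x y g"
  "dm (RDyn E M p \<theta>) (x, y, g) = x" "cd (RDyn E M p \<theta>) (x, y, g) = y"
  "ide (RDyn E M p \<theta>) x = (x, x, ide E (dm E (fst x)))"
  "(y', z, h) \<cdot>\<^bsub>RDyn E M p \<theta>\<^esub> (x, y, g) = (x, z, h \<cdot> g)"
  by (auto simp: RDyn_def split: prod.splits)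

lemma is_functor_reindex:
  assumes \<phi>: "(p, q, \<phi>1, \<phi>s) \<in> Ar (PolyE E)" and f: "(\<theta>, \<theta>', f) \<in> Ar (MPS E P M)"
  shows "is_functor (reindex_functor ((p, q, \<phi>1, \<phi>s), \<theta>, \<theta>', f))" (is "is_functor ?F")
proof (rule is_functor.intro)
  note sys = rewire_system[OF \<phi> f] and map = rewire_map[OF \<phi> f]
  show "category (Src ?F)" "category (Tgt ?F)" by (simp_all add: category_RDyn)
  show "fob ?F \<in> Ob (Src ?F) \<rightarrow>\<^sub>E Ob (Tgt ?F)" by (auto simp: RDyn_simps sys)
  show "far ?F \<in> extensional (Ar (Src ?F))" by simp
  show "far ?F g \<in> hom (Tgt ?F) (fob ?F x) (fob ?F y)" if "g \<in> hom (Src ?F) x y" for g x y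
    using that by (cases g) (auto simp: hom_def RDyn_simps sys map)
  show "far ?F (ide (Src ?F) x) = ide (Tgt ?F) (fob ?F x)" if "x \<in> Ob (Src ?F)" for x
  proof -
    have x: "ord_system E M p \<theta> x" using that by (simp add: RDyn_simps)
    then have "ide (RDyn E M p \<theta>) x \<in> Ar (RDyn E M p \<theta>)"
      using category.ide_hom[OF category_RDyn, of x p \<theta>] by (simp add: hom_def RDyn_simps)
    moreover have "dm E (fst (rewire (p, q, \<phi>1, \<phi>s) f x)) = dm E (fst x)"
      using x rewire_typed(4)[OF \<phi> f] by (cases x) (simp add: rewire_def)
    ultimately show ?thesis using x by (simp add: RDyn_simps)
  qed
  show "far ?F (h \<cdot>\<^bsub>Src ?F\<^esub> g) = far ?F h \<cdot>\<^bsub>Tgt ?F\<^esub> far ?F g"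
    if "g \<in> hom (Src ?F) x y" "h \<in> hom (Src ?F) y z" for g h x y z
  proof -
    have "h \<cdot>\<^bsub>RDyn E M p \<theta>\<^esub> g \<in> Ar (RDyn E M p \<theta>)"
      using category.cmp_hom[OF category_RDyn] that by (fastforce simp: hom_def)
    then show ?thesis
      using that by (cases g, cases h) (auto simp: hom_def RDyn_simps)
  qed
qed

lemma MPS_simps:
  "(\<Omega>, a, \<beta>) \<in> Ob (MPS E P M) \<longleftrightarrow> closed_system E M \<Omega> a \<and> invariant_measure E P M \<Omega> a \<beta>"
  "dm (MPS E P M) (\<theta>, \<theta>', f) = \<theta>" "cd (MPS E P M) (\<theta>, \<theta>', f) = \<theta>'"
  "ide (MPS E P M) (\<Omega>, a, \<beta>) = ((\<Omega>, a, \<beta>), (\<Omega>, a, \<beta>), ide E \<Omega>)"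
  "(\<theta>1, \<theta>'', g) \<cdot>\<^bsub>MPS E P M\<^esub> (\<theta>, \<theta>', f) = (\<theta>, \<theta>'', g \<cdot> f)"
  by (auto simp: MPS_def Let_def)

lemma PolyE_simps:
  "p \<in> Ob (PolyE E) \<longleftrightarrow> p \<in> Ar E"
  "dm (PolyE E) (p, q, \<phi>1, \<phi>s) = p" "cd (PolyE E) (p, q, \<phi>1, \<phi>s) = q"
  "ide (PolyE E) p = (p, p, ide E (cd E p), pb2 E (ide E (cd E p)) p)"
  "(q', r, \<psi>1, \<psi>s) \<cdot>\<^bsub>PolyE E\<^esub> (p, q, \<phi>1, \<phi>s)
     = (p, r, \<psi>1 \<cdot> \<phi>1, \<phi>s \<cdot> base_change E q r \<psi>1 \<psi>s \<phi>1)"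
  by (auto simp: PolyE_def)

lemma reindex_functor_ide:
  assumes p: "p \<in> Ob (PolyE E)" and \<theta>: "\<theta> \<in> Ob (MPS E P M)" and "is_monad E P"
  shows "reindex_functor (ide (PolyE E) p, ide (MPS E P M) \<theta>) = id_functor (RDyn E M p \<theta>)"
proof -
  interpret Poly: category "PolyE E" by (rule category_PolyE)
  interpret MPS: category "MPS E P M" by (rule category_MPS) fact
  obtain \<Omega> a \<beta> where \<theta>_eq: "\<theta> = (\<Omega>, a, \<beta>)" by (cases \<theta>)
  have "rewire (ide (PolyE E) p) (ide E \<Omega>) x = x" if "ord_system E M p \<theta> x" for x
    using rewire_ide p that by (simp add: PolyE_simps \<theta>_eq)
  note fix_ob = this[unfolded PolyE_simps]
  show ?thesis
  proof (rule functor_eqI)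
    have "(p, p, ide E (cd E p), pb2 E (ide E (cd E p)) p) \<in> Ar (PolyE E)"
      using Poly.ide_simps(1)[OF p] by (simp add: PolyE_simps)
    moreover have "(\<theta>, \<theta>, ide E \<Omega>) \<in> Ar (MPS E P M)"
      using MPS.ide_simps(1)[OF \<theta>] by (simp add: MPS_simps \<theta>_eq)
    ultimately show "is_functor (reindex_functor (ide (PolyE E) p, ide (MPS E P M) \<theta>))"
      using is_functor_reindex by (simp add: PolyE_simps MPS_simps \<theta>_eq)
    show "is_functor (id_functor (RDyn E M p \<theta>))" by (rule is_functor_id) (rule category_RDyn)
  qed (auto simp: \<theta>_eq PolyE_simps MPS_simps id_functor_def RDyn_simps fix_ob[unfolded \<theta>_eq])
qed

lemma reindex_functor_cmp:
  assumes \<phi>: "(p, q, \<phi>1, \<phi>s) \<in> Ar (PolyE E)" and f: "(\<theta>, \<theta>', f) \<in> Ar (MPS E P M)"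
    and \<psi>: "(q, r, \<psi>1, \<psi>s) \<in> Ar (PolyE E)" and g: "(\<theta>', \<theta>'', g) \<in> Ar (MPS E P M)"
    and "is_monad E P"
  shows "reindex_functor ((q, r, \<psi>1, \<psi>s) \<cdot>\<^bsub>PolyE E\<^esub> (p, q, \<phi>1, \<phi>s),
           (\<theta>', \<theta>'', g) \<cdot>\<^bsub>MPS E P M\<^esub> (\<theta>, \<theta>', f))
      = comp_functor (reindex_functor ((q, r, \<psi>1, \<psi>s), \<theta>', \<theta>'', g))
          (reindex_functor ((p, q, \<phi>1, \<phi>s), \<theta>, \<theta>', f))"
    (is "?L = comp_functor ?G ?F")
proof -
  interpret Poly: category "PolyE E" by (rule category_PolyE)
  interpret MPS: category "MPS E P M" by (rule category_MPS) fact
  have rw: "rewire (p, r, \<psi>1 \<cdot> \<phi>1, \<phi>s \<cdot> base_change E q r \<psi>1 \<psi>s \<phi>1) (g \<cdot> f) x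
      = rewire (q, r, \<psi>1, \<psi>s) g (rewire (p, q, \<phi>1, \<phi>s) f x)" if "ord_system E M p \<theta> x" for x
    using rewire_cmp[OF \<phi> f \<psi> g that] by (simp add: PolyE_simps)
  have F: "is_functor ?F" using \<phi> f by (rule is_functor_reindex)
  show ?thesis
  proof (rule functor_eqI)
    have "(p, r, \<psi>1 \<cdot> \<phi>1, \<phi>s \<cdot> base_change E q r \<psi>1 \<psi>s \<phi>1) \<in> Ar (PolyE E)"
      using Poly.cmp_simps(1)[OF \<phi> \<psi>] by (simp add: PolyE_simps)
    moreover have "(\<theta>, \<theta>'', g \<cdot> f) \<in> Ar (MPS E P M)"
      using MPS.cmp_simps(1)[OF f g] by (simp add: MPS_simps)
    ultimately show "is_functor ?L"
      using is_functor_reindex by (simp add: PolyE_simps MPS_simps)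
    show "is_functor (comp_functor ?G ?F)"
      using F is_functor_reindex[OF \<psi> g] by (rule is_functor_comp) simp
  qed (auto simp: PolyE_simps MPS_simps comp_functor_def compose_def RDyn_simps rw
      rewire_system[OF \<phi> f] rewire_map[OF \<phi> f])
qed

definition RDyn_indexed where
  "RDyn_indexed P = \<lparr>Src = product_cat (PolyE E) (MPS E P M), Tgt = Cat,
     fob = (\<lambda>(p, \<theta>)\<in>Ob (PolyE E) \<times> Ob (MPS E P M). RDyn E M p \<theta>),
     far = restrict reindex_functor (Ar (PolyE E) \<times> Ar (MPS E P M))\<rparr>"

lemma is_functor_RDyn_indexed:
  assumes P: "is_monad E P"
  shows "is_functor (RDyn_indexed P)" (is "is_functor ?R")
proof (rule is_functor.intro)
  interpret Poly: category "PolyE E" by (rule category_PolyE)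
  interpret MPS: category "MPS E P M" using P by (rule category_MPS)
  have fields: "Ob (Src ?R) = Ob (PolyE E) \<times> Ob (MPS E P M)"
    "Ar (Src ?R) = Ar (PolyE E) \<times> Ar (MPS E P M)"
    "dm (Src ?R) (\<phi>, u) = (dm (PolyE E) \<phi>, dm (MPS E P M) u)"
    "cd (Src ?R) (\<phi>, u) = (cd (PolyE E) \<phi>, cd (MPS E P M) u)"
    "ide (Src ?R) (p, \<theta>) = (ide (PolyE E) p, ide (MPS E P M) \<theta>)"
    "(\<psi>, v) \<cdot>\<^bsub>Src ?R\<^esub> (\<phi>, u) = (\<psi> \<cdot>\<^bsub>PolyE E\<^esub> \<phi>, v \<cdot>\<^bsub>MPS E P M\<^esub> u)"
    "fob ?R = (\<lambda>(p, \<theta>)\<in>Ob (PolyE E) \<times> Ob (MPS E P M). RDyn E M p \<theta>)"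
    "far ?R = restrict reindex_functor (Ar (PolyE E) \<times> Ar (MPS E P M))"
    "Tgt ?R = Cat" for \<phi> \<psi> u v p \<theta>
    by (simp_all add: RDyn_indexed_def product_cat_def)
  show "category (Src ?R)" "category (Tgt ?R)"
    using category_product_cat[OF Poly.category_axioms MPS.category_axioms] category_Cat
    by (simp_all add: RDyn_indexed_def)
  show "fob ?R \<in> Ob (Src ?R) \<rightarrow>\<^sub>E Ob (Tgt ?R)"
    by (auto simp: fields Cat_def category_RDyn)
  show "far ?R \<in> extensional (Ar (Src ?R))" by (simp add: fields)
  show "far ?R h \<in> hom (Tgt ?R) (fob ?R A) (fob ?R B)" if "h \<in> hom (Src ?R) A B" for h A B
  proof -
    obtain p q \<phi>1 \<phi>s \<theta> \<theta>' f where h: "h = ((p, q, \<phi>1, \<phi>s), \<theta>, \<theta>', f)" by (cases h) auto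
    have \<phi>: "(p, q, \<phi>1, \<phi>s) \<in> Ar (PolyE E)" and f: "(\<theta>, \<theta>', f) \<in> Ar (MPS E P M)"
      and AB: "A = (p, \<theta>)" "B = (q, \<theta>')"
      using that by (auto simp: hom_def h fields PolyE_simps MPS_simps)
    have "p \<in> Ob (PolyE E)" "q \<in> Ob (PolyE E)" "\<theta> \<in> Ob (MPS E P M)" "\<theta>' \<in> Ob (MPS E P M)"
      using Poly.dm_closed[OF \<phi>] Poly.cd_closed[OF \<phi>] MPS.dm_closed[OF f] MPS.cd_closed[OF f]
      by (simp_all add: PolyE_simps(2,3) MPS_simps(2,3))
    then show ?thesis
      using is_functor_reindex[OF \<phi> f] \<phi> f by (simp add: fields h AB hom_def Cat_def)
  qed
  show "far ?R (ide (Src ?R) A) = ide (Tgt ?R) (fob ?R A)" if "A \<in> Ob (Src ?R)" for A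
    using that P by (cases A) (simp add: fields reindex_functor_ide, simp add: Cat_def)
  show "far ?R (k \<cdot>\<^bsub>Src ?R\<^esub> h) = far ?R k \<cdot>\<^bsub>Tgt ?R\<^esub> far ?R h"
    if hk: "h \<in> hom (Src ?R) A B" "k \<in> hom (Src ?R) B D" for h k A B D
  proof -
    obtain p q \<phi>1 \<phi>s \<theta> \<theta>' f where h: "h = ((p, q, \<phi>1, \<phi>s), \<theta>, \<theta>', f)" by (cases h) auto
    obtain q' r \<psi>1 \<psi>s \<eta> \<theta>'' g where k: "k = ((q', r, \<psi>1, \<psi>s), \<eta>, \<theta>'', g)" by (cases k) auto
    have mid: "q' = q" "\<eta> = \<theta>'"
      using hk by (auto simp: hom_def h k fields PolyE_simps MPS_simps)
    have \<phi>: "(p, q, \<phi>1, \<phi>s) \<in> Ar (PolyE E)" and f: "(\<theta>, \<theta>', f) \<in> Ar (MPS E P M)"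
      and \<psi>: "(q, r, \<psi>1, \<psi>s) \<in> Ar (PolyE E)" and g: "(\<theta>', \<theta>'', g) \<in> Ar (MPS E P M)"
      using hk by (auto simp: hom_def h k mid fields)
    have "(q, r, \<psi>1, \<psi>s) \<cdot>\<^bsub>PolyE E\<^esub> (p, q, \<phi>1, \<phi>s) \<in> Ar (PolyE E)"
      "(\<theta>', \<theta>'', g) \<cdot>\<^bsub>MPS E P M\<^esub> (\<theta>, \<theta>', f) \<in> Ar (MPS E P M)"
      by (rule Poly.cmp_simps(1)[OF \<phi> \<psi>], simp add: PolyE_simps)
        (rule MPS.cmp_simps(1)[OF f g], simp add: MPS_simps)
    then show ?thesis
      using \<phi> f \<psi> g reindex_functor_cmp[OF \<phi> f \<psi> g P] by (simp add: fields h k mid) (simp add: Cat_def)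
  qed
qed

lemma RDyn_indexed_poly_map:
  assumes P: "is_monad E P" and \<phi>: "(p, q, \<phi>1, \<phi>s) \<in> Ar (PolyE E)" and \<theta>: "\<theta> \<in> Ob (MPS E P M)"
  shows "let F = far (RDyn_indexed P) ((p, q, \<phi>1, \<phi>s), ide (MPS E P M) \<theta>) in
        Src F = RDyn E M p \<theta> \<and> Tgt F = RDyn E M q \<theta> \<and>
        (\<forall>\<pi> out upd. (\<pi>, out, upd) \<in> Ob (RDyn E M p \<theta>) \<longrightarrow>
           fob F (\<pi>, out, upd) = (\<pi>, \<phi>1 \<cdot> out, upd \<cdot> base_change E p q \<phi>1 \<phi>s out)) \<and>
        (\<forall>x y f. (x, y, f) \<in> Ar (RDyn E M p \<theta>) \<longrightarrow> far F (x, y, f) = (fob F x, fob F y, f))"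
proof -
  interpret MPS: category "MPS E P M" using P by (rule category_MPS)
  obtain \<Omega> a \<beta> where \<theta>_eq: "\<theta> = (\<Omega>, a, \<beta>)" by (cases \<theta>)
  have "far (RDyn_indexed P) ((p, q, \<phi>1, \<phi>s), ide (MPS E P M) \<theta>)
      = reindex_functor ((p, q, \<phi>1, \<phi>s), \<theta>, \<theta>, ide E \<Omega>)"
    using \<phi> MPS.ide_simps(1)[OF \<theta>] by (simp add: RDyn_indexed_def MPS_simps \<theta>_eq)
  then show ?thesis
    by (auto simp: RDyn_simps rewire_def ord_system_def hom_def \<theta>_eq)
qed

lemma RDyn_indexed_base_map:
  assumes f: "(\<theta>, \<theta>', \<phi>) \<in> Ar (MPS E P M)" and p: "p \<in> Ob (PolyE E)"
  shows "let F = far (RDyn_indexed P) (ide (PolyE E) p, (\<theta>, \<theta>', \<phi>)) in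
        Src F = RDyn E M p \<theta> \<and> Tgt F = RDyn E M p \<theta>' \<and>
        (\<forall>\<pi> out upd. (\<pi>, out, upd) \<in> Ob (RDyn E M p \<theta>) \<longrightarrow>
           fob F (\<pi>, out, upd) = (\<phi> \<cdot> \<pi>, out, upd)) \<and>
        (\<forall>x y f. (x, y, f) \<in> Ar (RDyn E M p \<theta>) \<longrightarrow> far F (x, y, f) = (fob F x, fob F y, f))"
proof -
  interpret Poly: category "PolyE E" by (rule category_PolyE)
  have "far (RDyn_indexed P) (ide (PolyE E) p, (\<theta>, \<theta>', \<phi>))
      = reindex_functor ((p, p, ide E (cd E p), pb2 E (ide E (cd E p)) p), \<theta>, \<theta>', \<phi>)"
    using f Poly.ide_simps(1)[OF p] by (simp add: RDyn_indexed_def PolyE_simps)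
  then show ?thesis
    using p by (cases \<theta>) (auto simp: RDyn_simps PolyE_simps rewire_def ord_system_def hom_def)
qed

end

theorem proposition3p24:
  fixes E :: "('o, 'm) cat" and P :: "('o, 'm) smonad" and M :: "('o, 'm) monoid_obj"
  assumes "locally_cartesian_closed E"
    and "probability_monad E P"
    and "is_monoid_obj E M"
  shows "\<exists>R. is_functor R \<and> Src R = product_cat (PolyE E) (MPS E P M) \<and> Tgt R = Cat \<and>
    (\<forall>p\<in>Ob (PolyE E). \<forall>\<theta>\<in>Ob (MPS E P M). fob R (p, \<theta>) = RDyn E M p \<theta>) \<and>
    (\<forall>p q \<phi>1 \<phi>s \<theta>. (p, q, \<phi>1, \<phi>s) \<in> Ar (PolyE E) \<longrightarrow> \<theta> \<in> Ob (MPS E P M) \<longrightarrow>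
      (let F = far R ((p, q, \<phi>1, \<phi>s), ide (MPS E P M) \<theta>) in
        Src F = RDyn E M p \<theta> \<and> Tgt F = RDyn E M q \<theta> \<and>
        (\<forall>\<pi> out upd. (\<pi>, out, upd) \<in> Ob (RDyn E M p \<theta>) \<longrightarrow>
           fob F (\<pi>, out, upd) =
             (\<pi>, \<phi>1 \<cdot>\<^bsub>E\<^esub> out, upd \<cdot>\<^bsub>E\<^esub> base_change E p q \<phi>1 \<phi>s out)) \<and>
        (\<forall>x y f. (x, y, f) \<in> Ar (RDyn E M p \<theta>) \<longrightarrow>
           far F (x, y, f) = (fob F x, fob F y, f)))) \<and>
    (\<forall>\<theta> \<theta>' \<phi> p. (\<theta>, \<theta>', \<phi>) \<in> Ar (MPS E P M) \<longrightarrow> p \<in> Ob (PolyE E) \<longrightarrow>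
      (let F = far R (ide (PolyE E) p, (\<theta>, \<theta>', \<phi>)) in
        Src F = RDyn E M p \<theta> \<and> Tgt F = RDyn E M p \<theta>' \<and>
        (\<forall>\<pi> out upd. (\<pi>, out, upd) \<in> Ob (RDyn E M p \<theta>) \<longrightarrow>
           fob F (\<pi>, out, upd) = (\<phi> \<cdot>\<^bsub>E\<^esub> \<pi>, out, upd)) \<and>
        (\<forall>x y f. (x, y, f) \<in> Ar (RDyn E M p \<theta>) \<longrightarrow>
           far F (x, y, f) = (fob F x, fob F y, f))))"
proof -
  interpret lcc_category E
    using assms(1) by unfold_locales (auto simp: locally_cartesian_closed_def
        category.dm_closed category.cd_closed category.ide_hom category.cmp_hom
        category.ide_left category.ide_right category.assoc)
  interpret timed_category E M
    using assms(3) by unfold_locales (simp add: is_monoid_obj_def Let_def)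
  have P: "is_monad E P"
    using assms(2) by (simp add: probability_monad_def is_strong_monad_def)
  show ?thesis
  proof (intro exI[of _ "RDyn_indexed P"] conjI ballI allI impI)
    show "is_functor (RDyn_indexed P)" using P by (rule is_functor_RDyn_indexed)
  next
    show "Src (RDyn_indexed P) = product_cat (PolyE E) (MPS E P M)" "Tgt (RDyn_indexed P) = Cat"
      by (simp_all add: RDyn_indexed_def)
  next
    fix p \<theta> assume "p \<in> Ob (PolyE E)" "\<theta> \<in> Ob (MPS E P M)"
    then show "fob (RDyn_indexed P) (p, \<theta>) = RDyn E M p \<theta>" by (simp add: RDyn_indexed_def)
  qed (rule RDyn_indexed_poly_map[OF P] RDyn_indexed_base_map; assumption)+
qed

end
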